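(* There is no matrix $W\in\mathbb{R}^{6\times n}$ such that $rk_t(W)=3$, $rk_K(W)>3$, every row of $\mathcal P(W)$ contains at least one $0$, every column of $\mathcal P(W)$ has support either among $\{1,2,3\}$, $\{1,4,5\}$, $\{2,4,6\}$, $\{3,5,6\}$ or of cardinality at least $4$, and whenever the support of a column has cardinality $4$, no proper subset of it is the support of a column of $\mathcal P(W)$.
   Context: Tropical rank $rk_t$: largest $r$ such that the matrix has an $r\times r$ submatrix $S$ for which $\min_{\sigma}\sum_i s_{i\sigma(i)}$ is attained by exactly one permutation. Kapranov rank $rk_K(B)$: minimal rank over $\mathbf K$ of a matrix $A\in\mathbf K^{m\times n}$ with $\deg a_{ij}=b_{ij}$, where $\mathbf K$ is the field of formal sums $\sum_{e\in\mathbb{R}}a_et^e$ ($a_e\in\mathbb{C}$) with well-ordered support and $\deg$ is the minimal exponent ($\deg 0=\infty$). The pattern $\mathcal P(A)\in\{0,\infty\}^{m\times n}$ has $(u,v)$ entry $0$ if $a_{uv}=\min_i a_{iv}$ and $\infty$ otherwise; the support of a column of $\mathcal P(A)$ is the set of row indices where it is $0$. *)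

theory Defs
  imports "HOL-Analysis.Analysis"
begin

section \<open>Well-ordered sets of reals\<close>

lemma wo_real_iff:
  fixes S :: "real set"
  shows "wfp_on S (<) \<longleftrightarrow> \<not> (\<exists>s::nat \<Rightarrow> real. \<forall>n. s n \<in> S \<and> s (Suc n) < s n)"
proof
  assume S: "wfp_on S (<)"
  show "\<not> (\<exists>s::nat \<Rightarrow> real. \<forall>n. s n \<in> S \<and> s (Suc n) < s n)"
  proof
    assume "\<exists>s::nat \<Rightarrow> real. \<forall>n. s n \<in> S \<and> s (Suc n) < s n"
    then obtain s :: "nat \<Rightarrow> real" where s: "\<And>n. s n \<in> S" "\<And>n. s (Suc n) < s n"
      by blast
    have "range s \<subseteq> S" "range s \<noteq> {}" using s by auto
    then obtain z where "z \<in> range s" "\<And>y. y < z \<Longrightarrow> y \<notin> range s"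
      using S unfolding wfp_on_iff_ex_minimal by meson
    with s(2) show False by blast
  qed
next
  assume no: "\<not> (\<exists>s::nat \<Rightarrow> real. \<forall>n. s n \<in> S \<and> s (Suc n) < s n)"
  show "wfp_on S (<)"
    unfolding wfp_on_iff_ex_minimal
  proof (intro allI impI)
    fix B assume B: "B \<subseteq> S" "B \<noteq> {}"
    show "\<exists>z\<in>B. \<forall>y. y < z \<longrightarrow> y \<notin> B"
    proof (rule ccontr)
      assume "\<not> ?thesis"
      then have step: "\<exists>y. y \<in> B \<and> y < z" if "z \<in> B" for z
        using that by blast
      obtain b where "b \<in> B" using B by blast
      have "\<exists>s. \<forall>n. s n \<in> B \<and> s (Suc n) < s n"
        using dependent_nat_choice[of "\<lambda>_ x. x \<in> B" "\<lambda>_ x y. y < x"] \<open>b \<in> B\<close> step by blast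
      with no B show False by blast
    qed
  qed
qed

lemma wo_real_least:
  fixes S :: "real set"
  assumes "wfp_on S (<)" "S \<noteq> {}"
  shows "\<exists>m\<in>S. \<forall>x\<in>S. m \<le> x"
  using assms unfolding wfp_on_iff_ex_minimal by (meson not_le order_refl)

lemma wo_real_mono_subseq:
  fixes S :: "real set" and s :: "nat \<Rightarrow> real"
  assumes S: "wfp_on S (<)" and s: "\<And>n. s n \<in> S"
  obtains f :: "nat \<Rightarrow> nat"
  where "strict_mono f" "mono (\<lambda>n. s (f n))"
proof -
  obtain f :: "nat \<Rightarrow> nat" where f: "strict_mono f" "monoseq (\<lambda>n. s (f n))"
    using seq_monosub[of s] by blast
  from f(2) consider "\<forall>m n. m \<le> n \<longrightarrow> s (f m) \<le> s (f n)" | "\<forall>m n. m \<le> n \<longrightarrow> s (f n) \<le> s (f m)"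
    unfolding monoseq_def by argo
  then show thesis
  proof cases
    case 1
    show thesis by (rule that[OF f(1)]) (use 1 in \<open>simp add: mono_def\<close>)
  next
    case 2
    have "wfp_on (range (\<lambda>n. s (f n))) (<)"
      using S by (rule wfp_on_subset) (use s in auto)
    from wo_real_least[OF this] obtain k where k: "\<And>n. s (f k) \<le> s (f n)"
      by (auto simp: image_iff)
    have sm: "strict_mono (\<lambda>n. f (n + k))"
      using f(1) by (simp add: strict_mono_def)
    show thesis
    proof (rule that[OF sm], rule monoI)
      fix m n :: nat assume "m \<le> n"
      have "s (f (m + k)) \<le> s (f k)" using 2[rule_format, of k "m + k"] by simp
      also have "\<dots> \<le> s (f (n + k))" by (rule k)
      finally show "s (f (m + k)) \<le> s (f (n + k))" .
    qed
  qed
qed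

lemma wo_real_sumset:
  fixes A B :: "real set"
  assumes A: "wfp_on A (<)" and B: "wfp_on B (<)"
  shows "wfp_on {a + b | a b. a \<in> A \<and> b \<in> B} (<)"
  unfolding wo_real_iff
proof
  assume "\<exists>s. \<forall>n. s n \<in> {a + b | a b. a \<in> A \<and> b \<in> B} \<and> s (Suc n) < s n"
  then obtain s where s: "\<And>n. \<exists>a b. s n = a + b \<and> a \<in> A \<and> b \<in> B" "\<And>n. s (Suc n) < s n"
    by blast
  from s(1) obtain a b where ab: "\<And>n. s n = a n + b n" "\<And>n. a n \<in> A" "\<And>n. b n \<in> B"
    by metis
  obtain f :: "nat \<Rightarrow> nat" where f: "strict_mono f" "mono (\<lambda>n. a (f n))"
    by (rule wo_real_mono_subseq[where s = a, OF A ab(2)])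
  have dec: "s n < s m" if "m < n" for m n
    using lift_Suc_mono_less[of "\<lambda>n. - s n" m n] that s(2) by simp
  have "b (f (Suc n)) < b (f n)" for n
  proof -
    have "s (f (Suc n)) < s (f n)"
      using dec f(1) by (simp add: strict_mono_def)
    moreover have "a (f n) \<le> a (f (Suc n))" using monoD[OF f(2), of n "Suc n"] by simp
    ultimately show ?thesis using ab(1) by (smt (verit))
  qed
  with ab(3) have "\<exists>s. \<forall>n. s n \<in> B \<and> s (Suc n) < s n"
    by (intro exI[of _ "\<lambda>n. b (f n)"]) simp
  with B show False unfolding wo_real_iff by blast
qed

lemma wo_real_finite_fibre:
  fixes A B :: "real set"
  assumes A: "wfp_on A (<)" and B: "wfp_on B (<)"
  shows "finite {a \<in> A. x - a \<in> B}"
proof (rule ccontr)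
  assume "infinite {a \<in> A. x - a \<in> B}"
  then obtain s :: "nat \<Rightarrow> real" where s: "inj s" "range s \<subseteq> {a \<in> A. x - a \<in> B}"
    using infinite_countable_subset by blast
  have sA: "s n \<in> A" for n using s by blast
  obtain f :: "nat \<Rightarrow> nat" where f: "strict_mono f" "mono (\<lambda>n. s (f n))"
    by (rule wo_real_mono_subseq[where s = s, OF A sA])
  have "x - s (f (Suc n)) < x - s (f n)" for n
  proof -
    have "f n \<noteq> f (Suc n)" using f(1) by (metis n_not_Suc_n strict_mono_eq)
    then have "s (f n) \<noteq> s (f (Suc n))" using s(1) by (metis injD)
    with monoD[OF f(2), of n "Suc n"] show ?thesis by simp
  qed
  moreover have "x - s (f n) \<in> B" for n using s by blast
  ultimately have "\<exists>s. \<forall>n. s n \<in> B \<and> s (Suc n) < s n"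
    by (intro exI[of _ "\<lambda>n. x - s (f n)"]) simp
  with B show False unfolding wo_real_iff by blast
qed

section \<open>The field of generalized power series\<close>

text \<open>An element is the coefficient function $e \mapsto a_e$ of the formal sum
  $\sum_e a_e t^e$.\<close>

typedef hahn = "{f :: real \<Rightarrow> complex. wfp_on {e. f e \<noteq> 0} (<)}"
  morphisms hcoeff Abs_hahn
  by (rule exI[of _ "\<lambda>_. 0"]) (simp add: wfp_on_iff_ex_minimal)

setup_lifting type_definition_hahn

definition hsupp :: "hahn \<Rightarrow> real set" where
  "hsupp f = {e. hcoeff f e \<noteq> 0}"

lemma wo_hsupp: "wfp_on (hsupp f) (<)"
  using hcoeff[of f] by (simp add: hsupp_def)

lemma hahn_eqI: "(\<And>x. hcoeff f x = hcoeff g x) \<Longrightarrow> f = g"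
  by (metis ext hcoeff_inject)

lemma hcoeff_Abs: "wfp_on {e. f e \<noteq> 0} (<) \<Longrightarrow> hcoeff (Abs_hahn f) = f"
  by (simp add: Abs_hahn_inverse)

lemma wo_real_Un:
  fixes A B :: "real set"
  assumes "wfp_on A (<)" "wfp_on B (<)"
  shows "wfp_on (A \<union> B) (<)"
  unfolding wfp_on_iff_ex_minimal
proof (intro allI impI)
  fix C assume C: "C \<subseteq> A \<union> B" "C \<noteq> {}"
  have la: "C \<inter> A \<noteq> {} \<Longrightarrow> \<exists>m\<in>C \<inter> A. \<forall>x\<in>C \<inter> A. m \<le> x"
    by (rule wo_real_least[OF wfp_on_subset[OF assms(1)]]) auto
  have lb: "C \<inter> B \<noteq> {} \<Longrightarrow> \<exists>m\<in>C \<inter> B. \<forall>x\<in>C \<inter> B. m \<le> x"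
    by (rule wo_real_least[OF wfp_on_subset[OF assms(2)]]) auto
  have "\<exists>z\<in>C. \<forall>x\<in>C. z \<le> x"
  proof (cases "C \<inter> A = {} \<or> C \<inter> B = {}")
    case True
    then have "C \<subseteq> A \<or> C \<subseteq> B" using C(1) by blast
    then have "C \<inter> A = C \<or> C \<inter> B = C" by blast
    then show ?thesis using la lb C(2) by metis
  next
    case False
    then obtain m n where m: "m \<in> C \<inter> A" "\<forall>x\<in>C \<inter> A. m \<le> x"
      and n: "n \<in> C \<inter> B" "\<forall>x\<in>C \<inter> B. n \<le> x"
      using la lb by blast
    have "min m n \<in> C" using m n by (auto simp: min_def)
    moreover have "min m n \<le> x" if "x \<in> C" for x
      using that C(1) m(2) n(2) by (auto simp: min_le_iff_disj)
    ultimately show ?thesis by blast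
  qed
  then show "\<exists>z\<in>C. \<forall>y. y < z \<longrightarrow> y \<notin> C" using not_le by blast
qed

instantiation hahn :: "{zero, plus, uminus, minus}"
begin

lift_definition zero_hahn :: hahn is "\<lambda>_. 0"
  by (simp add: wfp_on_iff_ex_minimal)

lift_definition plus_hahn :: "hahn \<Rightarrow> hahn \<Rightarrow> hahn" is "\<lambda>f g x. f x + g x"
proof -
  fix f g :: "real \<Rightarrow> complex"
  assume "wfp_on {e. f e \<noteq> 0} (<)" "wfp_on {e. g e \<noteq> 0} (<)"
  from wo_real_Un[OF this] show "wfp_on {e. f e + g e \<noteq> 0} (<)"
    by (rule wfp_on_subset) auto
qed

lift_definition uminus_hahn :: "hahn \<Rightarrow> hahn" is "\<lambda>f x. - f x"
  by simp

definition minus_hahn :: "hahn \<Rightarrow> hahn \<Rightarrow> hahn" where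
  "minus_hahn f g = f + - g"

instance ..

end

lemma hcoeff_0 [simp]: "hcoeff 0 x = 0"
  and hcoeff_add [simp]: "hcoeff (f + g) x = hcoeff f x + hcoeff g x"
  and hcoeff_uminus [simp]: "hcoeff (- f) x = - hcoeff f x"
  and hcoeff_diff [simp]: "hcoeff (f - g) x = hcoeff f x - hcoeff g x"
  by (simp_all add: zero_hahn.rep_eq plus_hahn.rep_eq uminus_hahn.rep_eq minus_hahn_def)

instance hahn :: ab_group_add
  by standard (auto intro!: hahn_eqI simp: algebra_simps)

lemma hcoeff_sum: "hcoeff (sum F S) x = (\<Sum>i\<in>S. hcoeff (F i) x)"
  by (induction S rule: infinite_finite_induct) auto

definition hfibre :: "hahn \<Rightarrow> hahn \<Rightarrow> real \<Rightarrow> real set" where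
  "hfibre f g x = {a. hcoeff f a \<noteq> 0 \<and> hcoeff g (x - a) \<noteq> 0}"

lemma finite_hfibre: "finite (hfibre f g x)"
proof -
  have "hfibre f g x = {a \<in> hsupp f. x - a \<in> hsupp g}"
    by (auto simp: hfibre_def hsupp_def)
  then show ?thesis using wo_real_finite_fibre[OF wo_hsupp wo_hsupp] by simp
qed

definition hmonom :: "complex \<Rightarrow> real \<Rightarrow> hahn" where
  "hmonom c e = Abs_hahn (\<lambda>x. if x = e then c else 0)"

lemma hcoeff_hmonom [simp]: "hcoeff (hmonom c e) x = (if x = e then c else 0)"
proof -
  have "wfp_on {x. (if x = e then c else 0) \<noteq> 0} (<)"
    by (rule wfp_on_subset[of "{e}"]) (auto simp: wfp_on_iff_ex_minimal)
  then show ?thesis by (simp add: hmonom_def hcoeff_Abs)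
qed

instantiation hahn :: "{times, one}"
begin

text \<open>The product is the Cauchy product: the sum below has finite index set because both
  supports are well-ordered.\<close>

definition times_hahn :: "hahn \<Rightarrow> hahn \<Rightarrow> hahn" where
  "f * g = Abs_hahn (\<lambda>x. \<Sum>a | hcoeff f a \<noteq> 0 \<and> hcoeff g (x - a) \<noteq> 0.
     hcoeff f a * hcoeff g (x - a))"

definition one_hahn :: hahn where
  "1 = hmonom 1 0"

instance ..

end

lemma hcoeff_1 [simp]: "hcoeff 1 x = (if x = 0 then 1 else 0)"
  by (simp add: one_hahn_def)

lemma hcoeff_mult:
  "hcoeff (f * g) x = (\<Sum>a\<in>hfibre f g x. hcoeff f a * hcoeff g (x - a))"
proof -
  have "wfp_on {x. (\<Sum>a\<in>hfibre f g x. hcoeff f a * hcoeff g (x - a)) \<noteq> 0} (<)"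
  proof (rule wfp_on_subset[OF wo_real_sumset[OF wo_hsupp[of f] wo_hsupp[of g]]], safe)
    fix x assume "(\<Sum>a\<in>hfibre f g x. hcoeff f a * hcoeff g (x - a)) \<noteq> 0"
    then obtain a where "a \<in> hfibre f g x" by (metis sum.not_neutral_contains_not_neutral)
    then show "\<exists>a b. x = a + b \<and> a \<in> hsupp f \<and> b \<in> hsupp g"
      by (intro exI[of _ a] exI[of _ "x - a"]) (auto simp: hfibre_def hsupp_def)
  qed
  from hcoeff_Abs[OF this] show ?thesis
    by (simp add: times_hahn_def hfibre_def)
qed

lemma hcoeff_mult_superset:
  assumes "finite T" "hfibre f g x \<subseteq> T"
  shows "hcoeff (f * g) x = (\<Sum>a\<in>T. hcoeff f a * hcoeff g (x - a))"
  unfolding hcoeff_mult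
  by (rule sum.mono_neutral_left) (use assms in \<open>auto simp: hfibre_def\<close>)

lemma hcoeff_mult_nonzero:
  assumes "hcoeff (f * g) x \<noteq> 0"
  obtains a b where "x = a + b" "hcoeff f a \<noteq> 0" "hcoeff g b \<noteq> 0"
proof -
  from assms obtain a where "a \<in> hfibre f g x"
    unfolding hcoeff_mult by (metis sum.not_neutral_contains_not_neutral)
  then show ?thesis using that[of a "x - a"] by (auto simp: hfibre_def)
qed

lemma hcoeff_monom_mult: "hcoeff (hmonom c e * f) x = c * hcoeff f (x - e)"
proof -
  have "hcoeff (hmonom c e * f) x = (\<Sum>a\<in>{e}. hcoeff (hmonom c e) a * hcoeff f (x - a))"
    by (rule hcoeff_mult_superset) (auto simp: hfibre_def split: if_splits)
  then show ?thesis by simp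
qed

lemma hahn_mult_commute: "f * g = g * (f :: hahn)"
proof (rule hahn_eqI)
  fix x
  show "hcoeff (f * g) x = hcoeff (g * f) x"
    unfolding hcoeff_mult
    by (rule sum.reindex_bij_witness[of _ "\<lambda>a. x - a" "\<lambda>a. x - a"])
       (auto simp: hfibre_def mult.commute)
qed

lemma hahn_mult_assoc: "f * g * h = f * (g * (h :: hahn))"
proof (rule hahn_eqI)
  fix x
  define D where "D = {d \<in> {a + b | a b. a \<in> hsupp f \<and> b \<in> hsupp g}. x - d \<in> hsupp h}"
  define E where "E = {a \<in> hsupp f. x - a \<in> {b + c | b c. b \<in> hsupp g \<and> c \<in> hsupp h}}"
  have D: "finite D" unfolding D_def
    by (rule wo_real_finite_fibre[OF wo_real_sumset[OF wo_hsupp wo_hsupp] wo_hsupp])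
  have E: "finite E" unfolding E_def
    by (rule wo_real_finite_fibre[OF wo_hsupp wo_real_sumset[OF wo_hsupp wo_hsupp]])
  have "hcoeff (f * g * h) x = (\<Sum>d\<in>D. hcoeff (f * g) d * hcoeff h (x - d))"
  proof (rule hcoeff_mult_superset[OF D], rule)
    fix d assume "d \<in> hfibre (f * g) h x"
    then show "d \<in> D"
      unfolding D_def hfibre_def hsupp_def by (auto elim!: hcoeff_mult_nonzero)
  qed
  also have "\<dots> = (\<Sum>d\<in>D. \<Sum>a\<in>hfibre f g d. hcoeff f a * hcoeff g (d - a) * hcoeff h (x - d))"
    by (simp add: hcoeff_mult sum_distrib_right)
  also have "\<dots> = (\<Sum>(d, a)\<in>Sigma D (hfibre f g).
      hcoeff f a * hcoeff g (d - a) * hcoeff h (x - d))"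
    by (rule sum.Sigma) (auto simp: D finite_hfibre)
  also have "\<dots> = (\<Sum>(a, b)\<in>Sigma E (\<lambda>a. hfibre g h (x - a)).
      hcoeff f a * (hcoeff g b * hcoeff h (x - a - b)))"
  proof (rule sum.reindex_bij_witness[of _ "\<lambda>(a, b). (a + b, a)" "\<lambda>(d, a). (a, d - a)"])
    fix p assume "p \<in> Sigma D (hfibre f g)"
    then obtain d a where p: "p = (d, a)" "hcoeff h (x - d) \<noteq> 0" "hcoeff f a \<noteq> 0"
        "hcoeff g (d - a) \<noteq> 0"
      unfolding D_def hfibre_def hsupp_def by blast
    have "\<exists>b c. x - a = b + c \<and> b \<in> hsupp g \<and> c \<in> hsupp h"
      by (rule exI[of _ "d - a"], rule exI[of _ "x - d"]) (use p in \<open>auto simp: hsupp_def\<close>)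
    then show "(\<lambda>(d, a). (a, d - a)) p \<in> Sigma E (\<lambda>a. hfibre g h (x - a))"
      using p unfolding E_def hfibre_def hsupp_def by auto
  next
    fix q assume "q \<in> Sigma E (\<lambda>a. hfibre g h (x - a))"
    then obtain a b where q: "q = (a, b)" "hcoeff f a \<noteq> 0" "hcoeff g b \<noteq> 0"
        "hcoeff h (x - a - b) \<noteq> 0"
      unfolding E_def hfibre_def hsupp_def by blast
    then show "(\<lambda>(a, b). (a + b, a)) q \<in> Sigma D (hfibre f g)"
      unfolding D_def hfibre_def hsupp_def by (auto simp: algebra_simps)
  qed (auto simp: algebra_simps)
  also have "\<dots> = (\<Sum>a\<in>E. \<Sum>b\<in>hfibre g h (x - a).
      hcoeff f a * (hcoeff g b * hcoeff h (x - a - b)))"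
    by (rule sum.Sigma[symmetric]) (auto simp: E finite_hfibre)
  also have "\<dots> = (\<Sum>a\<in>E. hcoeff f a * hcoeff (g * h) (x - a))"
    by (simp add: hcoeff_mult sum_distrib_left)
  also have "\<dots> = hcoeff (f * (g * h)) x"
  proof (rule hcoeff_mult_superset[OF E, symmetric], rule)
    fix a assume "a \<in> hfibre f (g * h) x"
    then show "a \<in> E"
      unfolding E_def hfibre_def hsupp_def by (auto elim!: hcoeff_mult_nonzero)
  qed
  finally show "hcoeff (f * g * h) x = hcoeff (f * (g * h)) x" .
qed

lemma hahn_distrib_right: "(f + g) * h = f * h + g * (h :: hahn)"
proof (rule hahn_eqI)
  fix x
  let ?T = "hfibre f h x \<union> hfibre g h x"
  have T: "finite ?T" by (simp add: finite_hfibre)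
  have "hcoeff ((f + g) * h) x = (\<Sum>a\<in>?T. hcoeff (f + g) a * hcoeff h (x - a))"
    by (rule hcoeff_mult_superset[OF T]) (auto simp: hfibre_def)
  moreover have "hcoeff (f * h) x = (\<Sum>a\<in>?T. hcoeff f a * hcoeff h (x - a))"
    by (rule hcoeff_mult_superset[OF T]) auto
  moreover have "hcoeff (g * h) x = (\<Sum>a\<in>?T. hcoeff g a * hcoeff h (x - a))"
    by (rule hcoeff_mult_superset[OF T]) auto
  ultimately show "hcoeff ((f + g) * h) x = hcoeff (f * h + g * h) x"
    by (simp add: distrib_right sum.distrib)
qed

instance hahn :: comm_ring_1
proof
  fix f g h :: hahn
  show "f * g * h = f * (g * h)" by (rule hahn_mult_assoc)
  show "f * g = g * f" by (rule hahn_mult_commute)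
  show "(f + g) * h = f * h + g * h" by (rule hahn_distrib_right)
  show "1 * f = f"
    by (rule hahn_eqI) (simp add: one_hahn_def hcoeff_monom_mult)
  show "(0 :: hahn) \<noteq> 1"
    by (metis hcoeff_0 hcoeff_1 zero_neq_one)
qed

lemma hahn_geometric_inverse:
  assumes s: "0 < s" and g: "\<And>x. hcoeff g x \<noteq> 0 \<Longrightarrow> s \<le> x"
  shows "\<exists>h. (1 - g) * h = 1"
proof -
  have pow: "hcoeff (g ^ n) x \<noteq> 0 \<Longrightarrow> of_nat n * s \<le> x" for n x
  proof (induction n arbitrary: x)
    case 0
    then show ?case by (auto split: if_splits)
  next
    case (Suc n)
    from Suc.prems obtain a b where "x = a + b" "hcoeff g a \<noteq> 0" "hcoeff (g ^ n) b \<noteq> 0"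
      by (auto elim: hcoeff_mult_nonzero)
    with Suc.IH[of b] g[of a] show ?case by (simp add: algebra_simps)
  qed
  define H where "H n = (\<Sum>i\<le>n. g ^ i)" for n
  define N where "N x = nat \<lceil>x / s\<rceil>" for x
  have N: "x < of_nat (Suc n) * s" if "N x \<le> n" for x n
  proof -
    have "x / s \<le> of_nat n" using that unfolding N_def by linarith
    then have "x \<le> of_nat n * s" using s by (simp add: divide_le_eq)
    then show ?thesis using s by (simp add: algebra_simps)
  qed
  have pow0: "hcoeff (g ^ i) x = 0" if "N x < i" for i x
  proof (rule ccontr)
    assume "hcoeff (g ^ i) x \<noteq> 0"
    then have "of_nat i * s \<le> x" by (rule pow)
    moreover have "x < of_nat (Suc (i - 1)) * s" using that by (intro N) simp
    ultimately show False using that by simp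
  qed
  have H: "hcoeff (H n) x = hcoeff (H (N x)) x" if "N x \<le> n" for n x
    unfolding H_def hcoeff_sum
    by (rule sum.mono_neutral_right) (use that pow0 in \<open>auto simp: not_le\<close>)
  have Nmono: "N x \<le> N y" if "x \<le> y" for x y
    unfolding N_def using that s by (intro nat_mono ceiling_mono divide_right_mono) auto
  define h where "h = Abs_hahn (\<lambda>x. hcoeff (H (N x)) x)"
  have h: "hcoeff h x = hcoeff (H (N x)) x" for x
  proof -
    have "wfp_on {x. hcoeff (H (N x)) x \<noteq> 0} (<)"
      unfolding wo_real_iff
    proof
      assume "\<exists>u. \<forall>n. u n \<in> {x. hcoeff (H (N x)) x \<noteq> 0} \<and> u (Suc n) < u n"
      then obtain u where u: "\<And>n. hcoeff (H (N (u n))) (u n) \<noteq> 0" "\<And>n. u (Suc n) < u n"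
        by blast
      have "u n \<le> u 0" for n
        by (induction n) (use u(2) in \<open>auto intro: order_trans less_imp_le\<close>)
      then have "hcoeff (H (N (u 0))) (u n) \<noteq> 0" for n
        using H[OF Nmono] u(1) by metis
      then have "\<exists>u. \<forall>n. u n \<in> hsupp (H (N (u 0))) \<and> u (Suc n) < u n"
        using u(2) unfolding hsupp_def by blast
      then show False
        using \<open>\<And>n. hcoeff (H (N (u 0))) (u n) \<noteq> 0\<close> u(2) wo_hsupp[of "H (N (u 0))"]
        unfolding wo_real_iff hsupp_def by blast
    qed
    then show ?thesis unfolding h_def by (subst hcoeff_Abs) auto
  qed
  have "(1 - g) * h = 1"
  proof (rule hahn_eqI)
    fix x
    have eq: "hcoeff h (x - a) = hcoeff (H (N x)) (x - a)" if "hcoeff (1 - g) a \<noteq> 0" for a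
    proof -
      have "0 \<le> a" using that g[of a] s by (auto split: if_splits)
      then have "N (x - a) \<le> N x" by (intro Nmono) simp
      then show ?thesis using H h by metis
    qed
    have fib: "hfibre (1 - g) h x = hfibre (1 - g) (H (N x)) x"
      unfolding hfibre_def using eq by metis
    have "hcoeff ((1 - g) * h) x = hcoeff ((1 - g) * H (N x)) x"
      unfolding hcoeff_mult fib
      by (rule sum.cong) (use eq in \<open>auto simp: hfibre_def\<close>)
    also have "(1 - g) * H (N x) = 1 - g ^ Suc (N x)"
      unfolding H_def by (rule sum_gp_basic)
    also have "hcoeff (1 - g ^ Suc (N x)) x = hcoeff 1 x"
      using pow0[of x "Suc (N x)"] by simp
    finally show "hcoeff ((1 - g) * h) x = hcoeff 1 x" .
  qed
  then show ?thesis by blast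
qed

lemma hahn_least_exponent:
  assumes "f \<noteq> 0"
  shows "\<exists>e. hcoeff f e \<noteq> 0 \<and> (\<forall>x. hcoeff f x \<noteq> 0 \<longrightarrow> e \<le> x)"
proof -
  have "hsupp f \<noteq> {}" using assms hahn_eqI[of f 0] by (auto simp: hsupp_def)
  from wo_real_least[OF wo_hsupp this] show ?thesis by (auto simp: hsupp_def)
qed

lemma hahn_inverse_exists:
  assumes "f \<noteq> (0 :: hahn)"
  shows "\<exists>g. f * g = 1"
proof -
  obtain e where e: "hcoeff f e \<noteq> 0" "\<And>x. hcoeff f x \<noteq> 0 \<Longrightarrow> e \<le> x"
    using hahn_least_exponent[OF assms] by blast
  define m where "m = hmonom (inverse (hcoeff f e)) (- e)"
  define g where "g = 1 - m * f"
  have gc: "hcoeff g x = (if x = 0 then 1 else 0) - hcoeff f (x + e) / hcoeff f e" for x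
    by (simp add: g_def m_def hcoeff_monom_mult divide_inverse mult.commute[of "hcoeff f (x + e)"])
  have pos: "0 < x" if "hcoeff g x \<noteq> 0" for x
    using that e(1) e(2)[of "x + e"] by (cases "x = 0") (auto simp: gc split: if_splits)
  have "\<exists>s>0. \<forall>x. hcoeff g x \<noteq> 0 \<longrightarrow> s \<le> x"
  proof (cases "g = 0")
    case True
    then show ?thesis by (auto intro: exI[of _ 1])
  next
    case False
    then show ?thesis using hahn_least_exponent[OF False] pos by blast
  qed
  then obtain h where "(1 - g) * h = 1" using hahn_geometric_inverse by blast
  then have "f * (m * h) = 1" by (simp add: g_def mult_ac)
  then show ?thesis by blast
qed

instantiation hahn :: field
begin

definition inverse_hahn :: "hahn \<Rightarrow> hahn" where
  "inverse_hahn f = (if f = 0 then 0 else (SOME g. f * g = 1))"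

definition divide_hahn :: "hahn \<Rightarrow> hahn \<Rightarrow> hahn" where
  "divide_hahn f g = f * inverse g"

instance
proof
  fix f g :: hahn
  show "inverse f * f = 1" if "f \<noteq> 0"
    using someI_ex[OF hahn_inverse_exists[OF that]] that
    by (simp add: inverse_hahn_def mult.commute)
  show "f div g = f * inverse g" by (rule divide_hahn_def)
  show "inverse (0 :: hahn) = 0" by (simp add: inverse_hahn_def)
qed

end

definition hdeg :: "hahn \<Rightarrow> ereal" where
  "hdeg f = (if f = 0 then \<infinity> else ereal (LEAST e. hcoeff f e \<noteq> 0))"

section \<open>Tropical rank, Kapranov rank and patterns\<close>

text \<open>A square submatrix is given by row and column index sets of the same cardinality, and
  its permutations are the bijections from the row set to the column set. They are taken
  extensional so that a permutation is counted once.\<close>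

definition submatrix_perms :: "'a set \<Rightarrow> 'b set \<Rightarrow> ('a \<Rightarrow> 'b) set" where
  "submatrix_perms I J = {\<sigma> \<in> I \<rightarrow>\<^sub>E J. bij_betw \<sigma> I J}"

definition trop_nonsingular :: "real ^ 'n ^ 'm \<Rightarrow> 'm::finite set \<Rightarrow> 'n::finite set \<Rightarrow> bool" where
  "trop_nonsingular A I J \<longleftrightarrow>
    (\<exists>!\<sigma>. is_arg_min (\<lambda>\<sigma>. \<Sum>i\<in>I. A $ i $ \<sigma> i) (\<lambda>\<sigma>. \<sigma> \<in> submatrix_perms I J) \<sigma>)"

definition trop_rank :: "real ^ 'n ^ 'm \<Rightarrow> nat" where
  "trop_rank A = Max {r. \<exists>I J. card I = r \<and> card J = r \<and>
     trop_nonsingular A (I :: 'm::finite set) (J :: 'n::finite set)}"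

definition kapranov_rank :: "real ^ 'n ^ 'm \<Rightarrow> nat" where
  "kapranov_rank B = (LEAST r. \<exists>A :: hahn ^ 'n ^ 'm.
     (\<forall>i j. hdeg (A $ i $ j) = ereal (B $ i $ j)) \<and> rank A = r)"

definition trop_pattern :: "real ^ 'n ^ 'm \<Rightarrow> ereal ^ 'n ^ 'm" where
  "trop_pattern A =
     (\<chi> u v. if A $ u $ v = Min (range (\<lambda>i. A $ i $ v)) then 0 else \<infinity>)"

definition col_support :: "ereal ^ 'n ^ 'm \<Rightarrow> 'n \<Rightarrow> 'm set" where
  "col_support P v = {u. P $ u $ v = 0}"

end

(*
  Kapranov rank at most 3 means that all columns of W lie in the tropicalization of one
  three-dimensional subspace of K^6, given by six vectors of K^3, and such a subspace is written
  down explicitly. After subtracting column minima, the positive entries of a column sit inside a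
  pair of rows or exactly on one of the four triangles of the complete graph K4, whose edges are
  labelled by the rows.

  Since W has tropical rank 3, any four rows are tropically dependent; this is deduced from
  Brouwer's fixed point theorem. Applied to a triangle and one further row, the dependence says
  that the columns positive exactly on the triangle lie on a common tropical hyperplane. Either
  all three coefficients of the triangle are 0, or one of them is positive and then the other two
  rows of the triangle vanish in the same columns. If the first alternative holds for every
  triangle, a generic perturbation of the graphic matroid of K4 works, in which the minor of a
  triangle has the order prescribed by its hyperplane and all other minors are units. Otherwise
  two of the six vectors are chosen parallel to leading order.
*)

theory Submission
  imports Defs
begin

section \<open>Tropical dependence of rows\<close>

text \<open>Call a row a lone winner of a column if it is strictly minimal there after adding
  \<open>p\<close> to the rows. Raising the lone winners and renormalizing is a continuous self-map
  of a compact convex set of potentials; at a fixed point there are no lone winners.\<close>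

lemma tropical_dependence:
  fixes a :: "'m::finite \<Rightarrow> 'n::finite \<Rightarrow> real" and I :: "'m set"
  assumes I: "I \<noteq> {}"
    and no: "\<And>p. \<exists>i\<in>I. \<forall>j. \<exists>k\<in>I - {i}. p k + a k j \<le> p i + a i j"
  shows "\<exists>p. \<forall>j. \<forall>i\<in>I. \<exists>k\<in>I - {i}. p k + a k j \<le> p i + a i j"
proof -
  \<comment> \<open>\<open>g p i\<close> is positive iff some column attains its minimum only in row \<open>i\<close>. At a fixed point of
    \<open>F\<close> all \<open>g p i\<close> are equal, hence 0, because one of them vanishes by assumption.\<close>
  define g where "g = (\<lambda>(p :: real ^ 'm) i.
    min 1 (\<Sum>j\<in>UNIV. \<Prod>k\<in>I - {i}. max 0 ((p $ k + a k j) - (p $ i + a i j))))"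
  have g_nonneg: "0 \<le> g p i" and g_le: "g p i \<le> 1" for p i
    by (auto simp: g_def intro!: sum_nonneg prod_nonneg)
  have g_pos: "0 < g p i" if "\<forall>k\<in>I - {i}. p $ i + a i j < p $ k + a k j" for p i j
  proof -
    have "0 < (\<Prod>k\<in>I - {i}. max 0 ((p $ k + a k j) - (p $ i + a i j)))"
      using that by (intro prod_pos) auto
    then have "0 < (\<Sum>j\<in>UNIV. \<Prod>k\<in>I - {i}. max 0 ((p $ k + a k j) - (p $ i + a i j)))"
      by (intro sum_pos2[where i = j]) (auto intro!: prod_nonneg)
    then show ?thesis by (simp add: g_def)
  qed
  have g_posD: "\<exists>j. \<forall>k\<in>I - {i}. p $ i + a i j < p $ k + a k j" if "0 < g p i" for p i
  proof -
    have "0 < (\<Sum>j\<in>UNIV. \<Prod>k\<in>I - {i}. max 0 ((p $ k + a k j) - (p $ i + a i j)))"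
      using that by (simp add: g_def)
    then obtain j where "(\<Prod>k\<in>I - {i}. max 0 ((p $ k + a k j) - (p $ i + a i j))) \<noteq> 0"
      by (metis (no_types, lifting) less_irrefl sum.neutral)
    then have "max 0 ((p $ k + a k j) - (p $ i + a i j)) \<noteq> 0" if "k \<in> I - {i}" for k
      using that by simp
    then have "\<forall>k\<in>I - {i}. p $ i + a i j < p $ k + a k j"
      by (fastforce simp: max_def split: if_splits)
    then show ?thesis by blast
  qed
  define M where "M = (\<Sum>i\<in>UNIV. \<Sum>j\<in>UNIV. \<bar>a i j\<bar>)"
  have M: "\<bar>a i j\<bar> \<le> M" for i j
  proof -
    have "\<bar>a i j\<bar> \<le> (\<Sum>j\<in>UNIV. \<bar>a i j\<bar>)" by (rule member_le_sum) auto
    also have "\<dots> \<le> M" unfolding M_def by (rule member_le_sum) (auto intro: sum_nonneg)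
    finally show ?thesis .
  qed
  have M0: "0 \<le> M" unfolding M_def by (intro sum_nonneg) auto
  \<comment> \<open>Some coordinate of \<open>p\<close> is at most 0 because the sum vanishes.
    Comparing with it shows that a row strictly minimal in some column has coordinate at most
    \<open>2 * M\<close>; the map below adds at most 1 to it.\<close>
  define R where "R = 2 * M + 1"
  define S where "S = {p :: real ^ 'm. (\<forall>i. p $ i \<le> R) \<and> (\<forall>i. i \<notin> I \<longrightarrow> p $ i = 0) \<and>
    (\<Sum>i\<in>I. p $ i) = 0}"
  define N where "N = real (card I)"
  have N: "0 < N" using I by (simp add: N_def card_gt_0_iff)
  define avg where "avg p = (\<Sum>i\<in>I. g p i) / N" for p
  have avg0: "0 \<le> avg p" for p using N by (auto simp: avg_def intro!: sum_nonneg divide_nonneg_pos g_nonneg)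
  \<comment> \<open>Subtracting the average keeps the sum of the coordinates equal to 0.\<close>
  define F where "F = (\<lambda>p :: real ^ 'm. \<chi> i. if i \<in> I then p $ i + g p i - avg p else 0)"
  have "compact S"
  proof -
    have "closed S"
    proof -
      have "S = (\<Inter>i. {p. p $ i \<le> R}) \<inter> (\<Inter>i\<in>-I. {p. p $ i = 0}) \<inter> {p. (\<Sum>i\<in>I. p $ i) = 0}"
        by (auto simp: S_def)
      then show ?thesis
        by (auto intro!: closed_Int closed_INT closed_Collect_le closed_Collect_eq
              continuous_intros)
    qed
    moreover have "bounded S"
    proof -
      have "\<bar>p $ i\<bar> \<le> R + N * R" if "p \<in> S" for p i
      proof (cases "i \<in> I")
        case True
        \<comment> \<open>As the sum is 0, the upper bounds on the other coordinates bound this one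
          from below.\<close>
        have "(\<Sum>k\<in>I. p $ k) = p $ i + (\<Sum>k\<in>I - {i}. p $ k)"
          using True by (simp add: sum.remove)
        moreover have "(\<Sum>k\<in>I - {i}. p $ k) \<le> (\<Sum>k\<in>I - {i}. R)"
          using that by (intro sum_mono) (auto simp: S_def)
        moreover have "(\<Sum>k\<in>I - {i}. R) \<le> (\<Sum>k\<in>I. R)"
          using M0 by (intro sum_mono2) (auto simp: R_def)
        moreover have "(\<Sum>k\<in>I. R) = N * R" by (simp add: N_def)
        moreover have "0 \<le> N * R" "0 \<le> R" using N M0 by (auto simp: R_def)
        moreover have "p $ i \<le> R" "(\<Sum>k\<in>I. p $ k) = 0" using that by (auto simp: S_def)
        ultimately show ?thesis unfolding abs_le_iff by linarith
      next
        case False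
        then show ?thesis using that N M0 by (auto simp: S_def R_def)
      qed
      then have "S \<subseteq> cbox (\<chi> i. - (R + N * R)) (\<chi> i. R + N * R)"
        unfolding subset_iff mem_box_cart vec_lambda_beta abs_le_iff by (metis minus_le_iff)
      then show ?thesis using bounded_cbox bounded_subset by blast
    qed
    ultimately show ?thesis by (simp add: compact_eq_bounded_closed)
  qed
  moreover have "convex S"
    unfolding convex_def S_def
  proof safe
    fix x y :: "real ^ 'm" and u v :: real and i
    assume uv: "0 \<le> u" "0 \<le> v" "u + v = 1" and x: "\<forall>i. x $ i \<le> R" and y: "\<forall>i. y $ i \<le> R"
    have "u * x $ i + v * y $ i \<le> u * R + v * R"
      using uv x y by (intro add_mono mult_left_mono) auto
    also have "\<dots> = R" using uv by (metis distrib_right mult_1)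
    finally show "(u *\<^sub>R x + v *\<^sub>R y) $ i \<le> R" by simp
  qed (auto simp: sum.distrib simp flip: sum_distrib_left)
  moreover have "S \<noteq> {}"
    using M0 by (auto simp: S_def R_def intro!: exI[of _ 0])
  moreover have "continuous_on S F"
  proof -
    have "continuous_on S (\<lambda>p. g p i)" for i
      unfolding g_def by (intro continuous_intros)
    then have "continuous_on S (\<lambda>p. if i \<in> I then p $ i + g p i - avg p else 0)" for i
      unfolding avg_def using N by (cases "i \<in> I") (auto intro!: continuous_intros)
    then show ?thesis unfolding F_def by (intro continuous_on_vec_lambda) auto
  qed
  moreover have "F p \<in> S" if p: "p \<in> S" for p
  proof -
    have sum0: "(\<Sum>i\<in>I. p $ i) = 0" using p by (simp add: S_def)
    have "p $ i + g p i - avg p \<le> R" if i: "i \<in> I" for i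
    proof (cases "g p i = 0")
      case True
      then show ?thesis using p avg0[of p] by (auto simp: S_def intro: order_trans[of _ "p $ i"])
    next
      case False
      then have "0 < g p i" using g_nonneg[of p i] by simp
      then obtain j where j: "\<forall>k\<in>I - {i}. p $ i + a i j < p $ k + a k j" using g_posD by blast
      have "\<exists>k\<in>I. p $ k \<le> 0"
      proof (rule ccontr)
        assume "\<not> ?thesis"
        then have "0 < (\<Sum>k\<in>I. p $ k)" using I by (intro sum_pos) (auto simp: not_le)
        with sum0 show False by simp
      qed
      then obtain k where k: "k \<in> I" "p $ k \<le> 0" by blast
      have "p $ i \<le> 2 * M"
      proof (cases "k = i")
        case True
        then show ?thesis using k M0 by simp
      next
        case False
        then have "p $ i + a i j < p $ k + a k j" using j k by blast
        then show ?thesis using k(2) M[of i j] M[of k j] by (simp add: abs_le_iff)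
      qed
      then show ?thesis using g_le[of p i] avg0[of p] by (simp add: R_def)
    qed
    moreover have "0 \<le> R" using M0 by (simp add: R_def)
    moreover have "(\<Sum>i\<in>I. p $ i + g p i - avg p) = 0"
      using sum0 N by (simp add: sum_subtractf sum.distrib avg_def N_def)
    ultimately show ?thesis by (simp add: S_def F_def)
  qed
  ultimately obtain p where p: "p \<in> S" "F p = p"
    using brouwer[of S F] by blast
  have fixp: "g p i = avg p" if "i \<in> I" for i
  proof -
    have "F p $ i = p $ i" by (simp add: p(2))
    then show ?thesis using that by (simp add: F_def)
  qed
  obtain i0 where i0: "i0 \<in> I" "\<forall>j. \<exists>k\<in>I - {i0}. p $ k + a k j \<le> p $ i0 + a i0 j"
    using no[of "\<lambda>k. p $ k"] by blast
  have "g p i0 = 0"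
    using g_posD[of p i0] i0(2) g_nonneg[of p i0] by (metis not_le order_le_less)
  then have "g p i = 0" if "i \<in> I" for i using fixp i0(1) that by metis
  then show ?thesis
    using g_pos[of _ p] by (intro exI[of _ "\<lambda>k. p $ k"]) (metis less_irrefl not_le)
qed

text \<open>Adding \<open>p\<close> to the rows changes the sums of all permutations by the same
  constant. Afterwards row \<open>i\<close> is the only minimum of column \<open>c i\<close> within
  \<open>I\<close>, so sending each row to its own column is strictly cheapest.\<close>

lemma trop_nonsingularI:
  fixes A :: "real ^ 'n::finite ^ 'm::finite"
  assumes c: "\<And>i k. i \<in> I \<Longrightarrow> k \<in> I \<Longrightarrow> k \<noteq> i \<Longrightarrow> p i + A $ i $ c i < p k + A $ k $ c i"
  shows "inj_on c I" and "trop_nonsingular A I (c ` I)"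
proof -
  show inj: "inj_on c I"
  proof (rule inj_onI, rule ccontr)
    fix x y assume xy: "x \<in> I" "y \<in> I" "c x = c y" "x \<noteq> y"
    show False using c[of x y] c[of y x] xy by auto
  qed
  define \<tau> where "\<tau> = restrict c I"
  have \<tau>: "\<tau> \<in> submatrix_perms I (c ` I)"
    using inj by (auto simp: \<tau>_def submatrix_perms_def bij_betw_def inj_on_def)
  have less: "(\<Sum>i\<in>I. A $ i $ \<tau> i) < (\<Sum>i\<in>I. A $ i $ \<sigma> i)"
    if \<sigma>: "\<sigma> \<in> submatrix_perms I (c ` I)" "\<sigma> \<noteq> \<tau>" for \<sigma>
  proof -
    \<comment> \<open>\<open>k i\<close> is the row that owns the column \<open>\<sigma> i\<close>.
      Each entry used by \<open>\<sigma>\<close> is compared with the owner's entry in the same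
      column; since \<open>k\<close> permutes \<open>I\<close>, the terms of \<open>p\<close>
      cancel.\<close>
    define k where "k i = the_inv_into I c (\<sigma> i)" for i
    have bij: "bij_betw \<sigma> I (c ` I)" and ext: "\<sigma> \<in> I \<rightarrow>\<^sub>E c ` I"
      using \<sigma>(1) by (auto simp: submatrix_perms_def)
    have kI: "k i \<in> I" and ck: "c (k i) = \<sigma> i" if "i \<in> I" for i
      using that bij inj bij_betwE[OF bij] unfolding k_def
      by (auto intro: the_inv_into_into f_the_inv_into_f)
    have "bij_betw k I I"
    proof -
      have "bij_betw (the_inv_into I c) (c ` I) I"
        using inj by (simp add: bij_betw_the_inv_into inj_on_imp_bij_betw)
      from bij_betw_trans[OF bij this] show ?thesis
        by (simp add: k_def[abs_def] comp_def)
    qed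
    then have "(\<Sum>i\<in>I. p (k i) + A $ k i $ c (k i)) = (\<Sum>i\<in>I. p i + A $ i $ c i)"
      by (rule sum.reindex_bij_betw)
    moreover have "(\<Sum>i\<in>I. p (k i) + A $ k i $ c (k i)) < (\<Sum>i\<in>I. p i + A $ i $ \<sigma> i)"
    proof (rule sum_strict_mono_ex1)
      show "\<forall>i\<in>I. p (k i) + A $ k i $ c (k i) \<le> p i + A $ i $ \<sigma> i"
        using c kI ck by (metis order.refl less_imp_le)
      obtain i where i: "\<sigma> i \<noteq> \<tau> i" using \<sigma>(2) by blast
      then have iI: "i \<in> I" using ext by (metis PiE_arb \<tau>_def restrict_apply)
      then have "k i \<noteq> i" using i ck[OF iI] by (auto simp: \<tau>_def)
      then show "\<exists>i\<in>I. p (k i) + A $ k i $ c (k i) < p i + A $ i $ \<sigma> i"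
        using iI c[OF kI[OF iI] iI] ck[OF iI] by (intro bexI[of _ i]) auto
    qed simp
    ultimately have "(\<Sum>i\<in>I. A $ i $ c i) < (\<Sum>i\<in>I. A $ i $ \<sigma> i)"
      by (simp add: sum.distrib)
    then show ?thesis by (simp add: \<tau>_def cong: sum.cong)
  qed
  show "trop_nonsingular A I (c ` I)"
    unfolding trop_nonsingular_def
  proof (rule ex1I[of _ \<tau>])
    show "is_arg_min (\<lambda>\<sigma>. \<Sum>i\<in>I. A $ i $ \<sigma> i) (\<lambda>\<sigma>. \<sigma> \<in> submatrix_perms I (c ` I)) \<tau>"
      using \<tau> less unfolding is_arg_min_def by (metis less_irrefl less_not_sym)
  next
    fix \<sigma> assume "is_arg_min (\<lambda>\<sigma>. \<Sum>i\<in>I. A $ i $ \<sigma> i) (\<lambda>\<sigma>. \<sigma> \<in> submatrix_perms I (c ` I)) \<sigma>"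
    then show "\<sigma> = \<tau>" using \<tau> less unfolding is_arg_min_def by metis
  qed
qed

lemma trop_rank_ge:
  assumes "trop_nonsingular A I J" "card I = r" "card J = r"
  shows "r \<le> trop_rank A"
  unfolding trop_rank_def
proof (rule Max_ge)
  show "finite {r. \<exists>I J. card I = r \<and> card J = r \<and> trop_nonsingular A I J}"
    by (rule finite_subset[of _ "card ` UNIV"]) auto
qed (use assms in blast)

text \<open>If for some \<open>p\<close> every row of \<open>I\<close> were strictly minimal in a
  column of its own, these columns would give a nonsingular submatrix of size \<open>card I\<close>.
  This is the hypothesis of \<open>tropical_dependence\<close>.\<close>

lemma trop_rank_dependence:
  fixes A :: "real ^ 'n::finite ^ 'm::finite"
  assumes "trop_rank A < card I"
  shows "\<exists>p. \<forall>j. \<forall>i\<in>I. \<exists>k\<in>I - {i}. p k + A $ k $ j \<le> p i + A $ i $ j"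
proof (rule tropical_dependence)
  show "I \<noteq> {}" using assms by auto
  fix p
  show "\<exists>i\<in>I. \<forall>j. \<exists>k\<in>I - {i}. p k + A $ k $ j \<le> p i + A $ i $ j"
  proof (rule ccontr)
    assume "\<not> ?thesis"
    then obtain c where c: "\<And>i k. i \<in> I \<Longrightarrow> k \<in> I - {i} \<Longrightarrow> p i + A $ i $ c i < p k + A $ k $ c i"
      by (metis not_le)
    have "inj_on c I" "trop_nonsingular A I (c ` I)"
      using trop_nonsingularI[of I p A c] c by simp_all
    then have "card I \<le> trop_rank A"
      by (intro trop_rank_ge) (auto simp: card_image)
    with assms show False by simp
  qed
qed

section \<open>Orders of generalized power series\<close>

text \<open>Valuations enter as predicates on coefficients, which avoids infinite values: 0
  satisfies \<open>vge e\<close> for every \<open>e\<close>, and \<open>vat e\<close> for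
  none.\<close>

definition vge :: "real \<Rightarrow> hahn \<Rightarrow> bool" where
  "vge e f \<longleftrightarrow> (\<forall>x<e. hcoeff f x = 0)"

definition vat :: "real \<Rightarrow> hahn \<Rightarrow> bool" where
  "vat e f \<longleftrightarrow> vge e f \<and> hcoeff f e \<noteq> 0"

lemma vat_imp_vge: "vat e f \<Longrightarrow> vge e f"
  by (simp add: vat_def)

lemma vge_mono: "vge e f \<Longrightarrow> d \<le> e \<Longrightarrow> vge d f"
  by (auto simp: vge_def)

lemma vge_0 [simp]: "vge e 0"
  by (simp add: vge_def)

lemma vge_add: "vge e f \<Longrightarrow> vge e g \<Longrightarrow> vge e (f + g)"
  and vge_diff: "vge e f \<Longrightarrow> vge e g \<Longrightarrow> vge e (f - g)"
  by (auto simp: vge_def)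

lemma vat_uminus [simp]: "vat e (- f) \<longleftrightarrow> vat e f"
  by (simp add: vat_def vge_def)

lemma vge_mult:
  assumes "vge d f" "vge e g"
  shows "vge (d + e) (f * g)"
  unfolding vge_def
proof (intro allI impI, rule ccontr)
  fix x assume x: "x < d + e" "hcoeff (f * g) x \<noteq> 0"
  from x(2) obtain a b where "x = a + b" "hcoeff f a \<noteq> 0" "hcoeff g b \<noteq> 0"
    by (rule hcoeff_mult_nonzero)
  moreover from this have "d \<le> a" "e \<le> b" using assms by (auto simp: vge_def not_less[symmetric])
  ultimately show False using x(1) by simp
qed

lemma hcoeff_mult_lead:
  assumes "vge d f" "vge e g"
  shows "hcoeff (f * g) (d + e) = hcoeff f d * hcoeff g e"
proof -
  have "hcoeff (f * g) (d + e) = (\<Sum>a\<in>{d}. hcoeff f a * hcoeff g (d + e - a))"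
  proof (rule hcoeff_mult_superset)
    show "hfibre f g (d + e) \<subseteq> {d}"
    proof
      fix a assume "a \<in> hfibre f g (d + e)"
      then have "hcoeff f a \<noteq> 0" "hcoeff g (d + e - a) \<noteq> 0" by (auto simp: hfibre_def)
      then have "d \<le> a" "e \<le> d + e - a" using assms by (auto simp: vge_def not_less[symmetric])
      then show "a \<in> {d}" by simp
    qed
  qed simp
  then show ?thesis by simp
qed

lemma hdeg_eqI:
  assumes "vat e f"
  shows "hdeg f = ereal e"
proof -
  have "f \<noteq> 0" using assms by (auto simp: vat_def)
  moreover have "(LEAST x. hcoeff f x \<noteq> 0) = e"
    using assms by (intro Least_equality) (auto simp: vat_def vge_def not_less[symmetric])
  ultimately show ?thesis by (simp add: hdeg_def)
qed

lemma vge_hmonom: "d \<le> e \<Longrightarrow> vge d (hmonom c e)"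
  by (simp add: vge_def)

lemma vge_monom_mult: "vge d f \<Longrightarrow> e \<le> r + d \<Longrightarrow> vge e (hmonom c r * f)"
  by (rule vge_mono[OF vge_mult[OF vge_hmonom[OF order_refl]]])

lemma vat_monom_mult: "vat d f \<Longrightarrow> c \<noteq> 0 \<Longrightarrow> e = r + d \<Longrightarrow> vat e (hmonom c r * f)"
  by (auto simp: vat_def hcoeff_monom_mult intro: vge_monom_mult)

lemma hmonom_mult: "hmonom c d * hmonom b e = hmonom (c * b) (d + e)"
  by (rule hahn_eqI) (auto simp: hcoeff_monom_mult)

lemma vge_mult0: "vge 0 f \<Longrightarrow> vge 0 g \<Longrightarrow> vge 0 (f * g)"
  using vge_mult[of 0 f 0 g] by simp

lemma hcoeff_mult0: "vge 0 f \<Longrightarrow> vge 0 g \<Longrightarrow> hcoeff (f * g) 0 = hcoeff f 0 * hcoeff g 0"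
  using hcoeff_mult_lead[of 0 f 0 g] by simp

lemma vge_1 [simp]: "vge 0 1"
  by (simp add: vge_def)

lemma vat_0I: "vge 0 f \<Longrightarrow> hcoeff f 0 \<noteq> 0 \<Longrightarrow> vat 0 f"
  by (simp add: vat_def)

lemma vat_hmonom: "c \<noteq> 0 \<Longrightarrow> vat e (hmonom c e)"
  by (simp add: vat_def vge_def)

section \<open>Three-dimensional spaces and their minors\<close>

type_synonym 'k config = "'k \<Rightarrow> hahn \<times> hahn \<times> hahn"

text \<open>The coordinates of \<open>x\<close> are the values of one linear form on K^3 at the
  vectors \<open>L k\<close>, so this is the column space of the matrix with rows
  \<open>L k\<close>.\<close>

definition in_space :: "'k config \<Rightarrow> ('k \<Rightarrow> hahn) \<Rightarrow> bool" where
  "in_space L x \<longleftrightarrow> (\<exists>y1 y2 y3. \<forall>k. x k = (case L k of (a, b, c) \<Rightarrow> y1 * a + y2 * b + y3 * c))"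

text \<open>The determinant of three of the vectors, as the cross product of the first two paired
  with the third. For fixed \<open>f\<close> and \<open>g\<close> it is a linear form in
  \<open>L k\<close>, which puts \<open>minor L f g\<close> into the space.\<close>

definition minor :: "'k config \<Rightarrow> 'k \<Rightarrow> 'k \<Rightarrow> 'k \<Rightarrow> hahn" where
  "minor L f g k = (case L f of (f1, f2, f3) \<Rightarrow> case L g of (g1, g2, g3) \<Rightarrow> case L k of (k1, k2, k3) \<Rightarrow>
     (f2 * g3 - f3 * g2) * k1 + (f3 * g1 - f1 * g3) * k2 + (f1 * g2 - f2 * g1) * k3)"

lemma in_space_minor: "in_space L (minor L f g)"
  unfolding in_space_def minor_def
  by (cases "L f"; cases "L g") (auto intro!: exI split: prod.splits)

lemma in_space_add:
  assumes "in_space L x" "in_space L y"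
  shows "in_space L (\<lambda>k. x k + y k)"
proof -
  obtain x1 x2 x3 where x: "\<forall>k. x k = (case L k of (a, b, c) \<Rightarrow> x1 * a + x2 * b + x3 * c)"
    using assms(1) unfolding in_space_def by blast
  obtain y1 y2 y3 where y: "\<forall>k. y k = (case L k of (a, b, c) \<Rightarrow> y1 * a + y2 * b + y3 * c)"
    using assms(2) unfolding in_space_def by blast
  show ?thesis unfolding in_space_def
    by (rule exI[of _ "x1 + y1"], rule exI[of _ "x2 + y2"], rule exI[of _ "x3 + y3"])
       (use x y in \<open>auto simp: algebra_simps split: prod.splits\<close>)
qed

lemma in_space_mult:
  assumes "in_space L x"
  shows "in_space L (\<lambda>k. r * x k)"
proof -
  obtain x1 x2 x3 where x: "\<forall>k. x k = (case L k of (a, b, c) \<Rightarrow> x1 * a + x2 * b + x3 * c)"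
    using assms unfolding in_space_def by blast
  show ?thesis unfolding in_space_def
    by (rule exI[of _ "r * x1"], rule exI[of _ "r * x2"], rule exI[of _ "r * x3"])
       (use x in \<open>auto simp: algebra_simps split: prod.splits\<close>)
qed

lemma in_space_0: "in_space L (\<lambda>k. 0)"
  using in_space_mult[OF in_space_minor, of L 0] by simp

lemma minor_swap: "minor L g f k = - minor L f g k" "minor L f k g = - minor L f g k"
  and minor_rot: "minor L g k f = minor L f g k"
  by (auto simp: minor_def algebra_simps split: prod.splits)

lemma minor_eq_0 [simp]: "minor L f f k = 0" "minor L f g f = 0" "minor L f g g = 0"
  by (auto simp: minor_def algebra_simps split: prod.splits)

lemma vat_minor_perm:
  assumes "vat e (minor L f g k)"
  shows "vat e (minor L f k g)" "vat e (minor L g f k)" "vat e (minor L g k f)"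
    "vat e (minor L k f g)" "vat e (minor L k g f)"
  using assms by (metis minor_swap minor_rot vat_uminus)+

section \<open>Lifting a column one coordinate at a time\<close>

definition liftable_at :: "'k config \<Rightarrow> ('k \<Rightarrow> real) \<Rightarrow> 'k \<Rightarrow> bool" where
  "liftable_at L w i \<longleftrightarrow> (\<exists>x. in_space L x \<and> (\<forall>k. vge (w k) (x k)) \<and> vat (w i) (x i))"

text \<open>The witness is the row of minors through \<open>f\<close> and \<open>g\<close> times the
  monomial of exponent \<open>e\<close>. It is 0 at \<open>f\<close> and \<open>g\<close>, which
  meets every lower bound.\<close>

lemma liftable_minor:
  assumes "\<And>k. vge (w k - e) (minor L f g k)" "vat (w i - e) (minor L f g i)"
  shows "liftable_at L w i"
  unfolding liftable_at_def
  using assms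
  by (intro exI[of _ "\<lambda>k. hmonom 1 e * minor L f g k"])
     (auto intro!: in_space_mult in_space_minor vge_monom_mult vat_monom_mult)

text \<open>A generic complex combination of the vectors witnessing \<^const>\<open>liftable_at\<close> attains all
  orders at once.\<close>

lemma liftable_all:
  fixes w :: "'k::finite \<Rightarrow> real"
  assumes "\<And>i. liftable_at L w i"
  obtains x where "in_space L x" "\<And>k. vat (w k) (x k)"
proof -
  have "\<exists>x. in_space L x \<and> (\<forall>k. vge (w k) (x k)) \<and> (\<forall>k\<in>S. vat (w k) (x k))"
    if "finite S" for S
    using that
  proof (induction S)
    case empty
    show ?case by (rule exI[of _ "\<lambda>k. 0"]) (simp add: in_space_0)
  next
    case (insert i S)
    then obtain x where x: "in_space L x" "\<And>k. vge (w k) (x k)" "\<And>k. k \<in> S \<Longrightarrow> vat (w k) (x k)"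
      by blast
    obtain y where y: "in_space L y" "\<And>k. vge (w k) (y k)" "vat (w i) (y i)"
      using assms[of i] unfolding liftable_at_def by blast
    define c where "c k = hcoeff (x k) (w k)" for k
    define d where "d k = hcoeff (y k) (w k)" for k
    \<comment> \<open>\<open>z\<close> avoids the finitely many values cancelling
      \<open>c k + z * d k\<close> for some \<open>k\<close> with \<open>d k\<close> nonzero. Where
      \<open>d k = 0\<close> and an exact order is wanted, \<open>k\<close> lies in \<open>S\<close>
      and \<open>c k\<close> survives.\<close>
    obtain z where z: "z \<notin> (\<lambda>k. - c k / d k) ` UNIV \<union> {0 :: complex}"
      using ex_new_if_finite[OF infinite_UNIV_char_0] by (metis finite finite.emptyI finite.insertI finite_UnI finite_imageI)
    define u where "u k = x k + hmonom z 0 * y k" for k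
    have "in_space L u" unfolding u_def by (intro in_space_add in_space_mult x y)
    moreover have vu: "vge (w k) (u k)" for k
      unfolding u_def by (intro vge_add x vge_monom_mult[OF y(2)]) simp
    moreover have "vat (w k) (u k)" if "k \<in> insert i S" for k
    proof -
      have "hcoeff (u k) (w k) = c k + z * d k"
        by (simp add: u_def c_def d_def hcoeff_monom_mult)
      moreover have "c k \<noteq> 0 \<or> d k \<noteq> 0"
        using that x(3) y(3) by (auto simp: vat_def c_def d_def)
      moreover have "z \<noteq> 0" "d k \<noteq> 0 \<Longrightarrow> z \<noteq> - c k / d k" using z by auto
      ultimately have "hcoeff (u k) (w k) \<noteq> 0"
        by (cases "d k = 0") (auto simp: field_simps eq_neg_iff_add_eq_0 add.commute)
      then show ?thesis using vu by (simp add: vat_def)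
    qed
    ultimately show ?case by blast
  qed
  from this[of UNIV] that show ?thesis by auto
qed

text \<open>Multiplying column \<open>j\<close> by the monomial of exponent \<open>s j\<close>
  undoes the shift and keeps the column in the space, so the lifted matrix factors through
  K^3.\<close>

lemma kapranov_rank_le_3:
  fixes W :: "real ^ 'n::finite ^ 'm::finite"
  assumes "\<And>i j. liftable_at L (\<lambda>i. W $ i $ j - s j) i"
  shows "kapranov_rank W \<le> 3"
proof -
  have "\<exists>x. in_space L x \<and> (\<forall>k. vat (W $ k $ j - s j) (x k))" for j
    using liftable_all[OF assms, of j] by metis
  then obtain X where X: "\<And>j. in_space L (X j)" "\<And>j k. vat (W $ k $ j - s j) (X j k)"
    by metis
  define A where "A = (\<chi> k j. hmonom 1 (s j) * X j k)"
  have deg: "hdeg (A $ i $ j) = ereal (W $ i $ j)" for i j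
    unfolding A_def using X(2) by (auto intro!: hdeg_eqI vat_monom_mult)
  have "\<exists>y1 y2 y3. \<forall>k. A $ k $ j = (case L k of (a, b, c) \<Rightarrow> y1 * a + y2 * b + y3 * c)" for j
    using in_space_mult[OF X(1), of "hmonom 1 (s j)" j] unfolding A_def in_space_def by simp
  then obtain Y1 Y2 Y3 where
    Y: "\<And>j k. A $ k $ j = (case L k of (a, b, c) \<Rightarrow> Y1 j * a + Y2 j * b + Y3 j * c)"
    by metis
  \<comment> \<open>Row \<open>k\<close> of the lift is the combination of these three vectors whose
    coefficients are the entries of \<open>L k\<close>.\<close>
  define B where "B = {\<chi> j. Y1 j, \<chi> j. Y2 j, \<chi> j. Y3 j}"
  have "rows A \<subseteq> vec.span B"
  proof
    fix r assume "r \<in> rows A"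
    then obtain k where k: "r = A $ k" by (auto simp: rows_def row_def vec_nth_inverse)
    obtain a b c where L: "L k = (a, b, c)" by (cases "L k") auto
    have "r = a *s (\<chi> j. Y1 j) + b *s (\<chi> j. Y2 j) + c *s (\<chi> j. Y3 j)"
      by (simp add: vec_eq_iff k Y L mult.commute)
    also have "\<dots> \<in> vec.span B"
      unfolding B_def by (intro vec.span_add vec.span_scale vec.span_base) auto
    finally show "r \<in> vec.span B" .
  qed
  then have "rank A \<le> card B"
    unfolding row_rank_def_gen by (rule vec.dim_le_card) (simp add: B_def)
  also have "\<dots> \<le> 3" unfolding B_def by (simp add: card_insert_if)
  finally have "rank A \<le> 3" .
  moreover have "kapranov_rank W \<le> rank A"
    unfolding kapranov_rank_def by (rule Least_le) (use deg in blast)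
  ultimately show ?thesis by simp
qed

section \<open>Columns positive on a pair or on a triangle of rows\<close>

lemma vge_minor:
  assumes "\<And>k. case L k of (a, b, c) \<Rightarrow> vge 0 a \<and> vge 0 b \<and> vge 0 c"
  shows "vge 0 (minor L f g k)"
proof -
  have mult: "vge 0 (x * y)" if "vge 0 x" "vge 0 y" for x y
    using vge_mult[OF that] by simp
  show ?thesis
    using assms[of f] assms[of g] assms[of k]
    by (auto simp: minor_def intro!: vge_add vge_diff mult split: prod.splits)
qed

text \<open>Membership in a tropical hyperplane: the minimum of the four numbers is attained at
  least twice.\<close>

definition min_twice :: "real \<Rightarrow> real \<Rightarrow> real \<Rightarrow> real \<Rightarrow> bool" where
  "min_twice a b c d \<longleftrightarrow> (b \<le> a \<or> c \<le> a \<or> d \<le> a) \<and> (a \<le> b \<or> c \<le> b \<or> d \<le> b) \<and>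
     (a \<le> c \<or> b \<le> c \<or> d \<le> c) \<and> (a \<le> d \<or> b \<le> d \<or> c \<le> d)"

text \<open>For integral vectors: modulo positive orders, no third vector lies on the projective
  line through \<open>f\<close> and \<open>g\<close>.\<close>

definition generic_pair :: "'k config \<Rightarrow> 'k \<Rightarrow> 'k \<Rightarrow> bool" where
  "generic_pair L f g \<longleftrightarrow> (\<forall>k. k \<noteq> f \<longrightarrow> k \<noteq> g \<longrightarrow> vat 0 (minor L f g k))"

lemma generic_pair_commute: "generic_pair L f g \<longleftrightarrow> generic_pair L g f"
  unfolding generic_pair_def by (metis vat_minor_perm(2))

text \<open>The minors through \<open>f\<close> and \<open>g\<close> vanish there and are units
  elsewhere, which handles the other coordinates. For coordinate \<open>f\<close>, the minors
  through \<open>g\<close> and a further \<open>h\<close>, scaled by the exponent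
  \<open>w f\<close>, vanish at \<open>g\<close> and have order exactly \<open>w f\<close> at
  \<open>f\<close>.\<close>

lemma liftable_pair:
  assumes int: "\<And>f g k. vge 0 (minor L f g k)"
    and w: "\<And>k. 0 \<le> w k" "{k. w k \<noteq> 0} \<subseteq> {f, g}"
    and fg: "generic_pair L f g" and h: "h \<noteq> f" "h \<noteq> g" "f \<noteq> g"
  shows "liftable_at L w i"
proof -
  have w0: "w k = 0" if "k \<noteq> f" "k \<noteq> g" for k using w(2) that by blast
  have *: "liftable_at L w f" if "{k. w k \<noteq> 0} \<subseteq> {f, g}" "generic_pair L f g" "h \<noteq> f" "h \<noteq> g" for f g
  proof (rule liftable_minor[where f = g and g = h and e = "w f"])
    show "vat (w f - w f) (minor L g h f)"
      using that minor_rot[of L g h f] by (simp add: generic_pair_def)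
    fix k
    have "k = f \<or> k = g \<or> w k = 0" using that(1) by blast
    then show "vge (w k - w f) (minor L g h k)"
      using w(1)[of f] vge_mono[OF int] by auto
  qed
  consider "i = f" | "i = g" | "i \<noteq> f" "i \<noteq> g" by blast
  then show ?thesis
  proof cases
    case 1
    then show ?thesis using *[of f g] w(2) fg h by simp
  next
    case 2
    then show ?thesis using *[of g f] w(2) fg h by (simp add: generic_pair_commute insert_commute)
  next
    case 3
    show ?thesis
    proof (rule liftable_minor[where f = f and g = g and e = 0])
      show "vat (w i - 0) (minor L f g i)" using 3 fg w0 by (simp add: generic_pair_def)
      fix k show "vge (w k - 0) (minor L f g k)"
        using int w0[of k] by (cases "k = f \<or> k = g") auto
    qed
  qed
qed

text \<open>Each witness is a monomial multiple of a row of minors; which row is used is decided by the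
  position of the minimum.\<close>

lemma liftable_star:
  assumes int: "\<And>f g k. vge 0 (minor L f g k)"
    and w: "\<And>k. 0 \<le> w k" "{k. w k \<noteq> 0} = {d, e, f}" and dist: "d \<noteq> e" "d \<noteq> f" "e \<noteq> f"
    and def: "vat q (minor L d e f)"
    and efk: "\<And>k. k \<notin> {d, e, f} \<Longrightarrow> vat p (minor L e f k)"
    and dek: "\<And>k. k \<notin> {d, e, f} \<Longrightarrow> vat 0 (minor L d e k)"
    and dfk: "\<And>k. k \<notin> {d, e, f} \<Longrightarrow> vat 0 (minor L d f k)"
    and p: "0 \<le> p" and h: "h \<notin> {d, e, f}"
    and min: "min_twice (w e) (w f) (w d + p) q"
  shows "liftable_at L w i"
proof -
  have w0: "w k = 0" if "k \<noteq> d" "k \<noteq> e" "k \<noteq> f" for k using w(2) that by blast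
  have efd: "vat q (minor L e f d)" and edf: "vat q (minor L d f e)"
    using vat_minor_perm[OF def] by blast+
  have ehf: "vat p (minor L e h f)" and fhe: "vat p (minor L f h e)"
    using vat_minor_perm[OF efk[OF h]] by blast+
  have ehd: "vat 0 (minor L e h d)" and dhe: "vat 0 (minor L d h e)"
    using vat_minor_perm[OF dek[OF h]] by blast+
  have fhd: "vat 0 (minor L f h d)" and dhf: "vat 0 (minor L d h f)"
    using vat_minor_perm[OF dfk[OF h]] by blast+
  have int': "vge x (minor L f g k)" if "x \<le> 0" for x f g k using vge_mono[OF int that] .
  \<comment> \<open>The minors through \<open>d\<close> and one of \<open>e\<close>,
    \<open>f\<close> are units outside the triangle; they are admissible if their order
    \<open>q\<close> at the remaining row reaches the value of \<open>w\<close> there.\<close>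
  have star: "liftable_at L w j" if j: "j \<notin> {d, e, f}" for j
  proof -
    consider "w f \<le> q" | "w e \<le> q" | "q < w e" "q < w f" by linarith
    then show ?thesis
    proof cases
      case 1
      have "vge (w k - 0) (minor L d e k)" for k
        using w0[of k] int 1 vge_mono[OF vat_imp_vge[OF def]] by (cases "k \<in> {d, e, f}") auto
      then show ?thesis using liftable_minor[of w 0 L d e j] dek[OF j] w0[of j] j by simp
    next
      case 2
      have "vge (w k - 0) (minor L d f k)" for k
        using w0[of k] int 2 vge_mono[OF vat_imp_vge[OF edf]] by (cases "k \<in> {d, e, f}") auto
      then show ?thesis using liftable_minor[of w 0 L d f j] dfk[OF j] w0[of j] j by simp
    next
      case 3
      \<comment> \<open>Neither \<open>w e\<close> nor \<open>w f\<close> is minimal, so the other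
        two numbers share the minimum. The minors through \<open>e\<close> and \<open>f\<close>,
        scaled by the exponent \<open>- p\<close>, then have order \<open>w d\<close> at
        \<open>d\<close> and 0 outside the triangle.\<close>
      then have q: "w d + p = q" using min by (auto simp: min_twice_def)
      have "vge (w k - (- p)) (minor L e f k)" for k
        using w0[of k] vge_mono[OF vat_imp_vge[OF efd]] vat_imp_vge[OF efk[of k]] q
        by (cases "k \<in> {d, e, f}") auto
      then show ?thesis using liftable_minor[of w "- p" L e f j] efk[OF j] w0[of j] j by simp
    qed
  qed
  have center: "liftable_at L w d"
  proof -
    consider "w f \<le> w d + p" | "w e \<le> w d + p" | "w d + p < w e" "w d + p < w f" by linarith
    then show ?thesis
    proof cases
      case 1
      have "vge (w k - w d) (minor L e h k)" for k
        using w0[of k] w(1)[of d] int' 1 vge_mono[OF vat_imp_vge[OF ehf]] by (cases "k \<in> {d, e, f}") auto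
      then show ?thesis using liftable_minor[of w "w d" L e h d] ehd by simp
    next
      case 2
      have "vge (w k - w d) (minor L f h k)" for k
        using w0[of k] w(1)[of d] int' 2 vge_mono[OF vat_imp_vge[OF fhe]] by (cases "k \<in> {d, e, f}") auto
      then show ?thesis using liftable_minor[of w "w d" L f h d] fhd by simp
    next
      case 3
      then have q: "w d + p = q" using min by (auto simp: min_twice_def)
      have "vge (w k - (- p)) (minor L e f k)" for k
        using w0[of k] vge_mono[OF vat_imp_vge[OF efd]] vat_imp_vge[OF efk[of k]] q
        by (cases "k \<in> {d, e, f}") auto
      then show ?thesis using liftable_minor[of w "- p" L e f d] efd q by (simp add: algebra_simps)
    qed
  qed
  \<comment> \<open>Quantified over \<open>e\<close> and \<open>f\<close> afresh: these two rows
    enter symmetrically, and the result is applied in both orders.\<close>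
  have side: "liftable_at L w e"
    if "min_twice (w e) (w f) (w d + p) q" "{k. w k \<noteq> 0} = {d, e, f}"
      and dhe: "vat 0 (minor L d h e)" and fhe: "vat p (minor L f h e)"
      and edf: "vat q (minor L d f e)" and h: "h \<notin> {d, e, f}" for e f
  proof -
    have w0: "w k = 0" if "k \<noteq> d" "k \<noteq> e" "k \<noteq> f" for k using \<open>{k. w k \<noteq> 0} = {d, e, f}\<close> that by blast
    consider "w f \<le> w e" | "w d + p \<le> w e" | "w e < w f" "w e < w d + p" by linarith
    then show ?thesis
    proof cases
      case 1
      have "vge (w k - w e) (minor L d h k)" for k
        using w0[of k] w(1)[of e] int' 1 by (cases "k \<in> {d, e, f}") auto
      then show ?thesis using liftable_minor[of w "w e" L d h e] dhe by simp
    next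
      case 2
      have "vge (w k - (w e - p)) (minor L f h k)" for k
        using w0[of k] w(1)[of d] int' 2 vat_imp_vge[OF fhe] by (cases "k \<in> {d, e, f}") auto
      then show ?thesis using liftable_minor[of w "w e - p" L f h e] fhe by simp
    next
      case 3
      then have q: "q = w e" using that(1) by (auto simp: min_twice_def)
      have "vge (w k - 0) (minor L d f k)" for k
        using w0[of k] int' vat_imp_vge[OF edf] q by (cases "k \<in> {d, e, f}") auto
      then show ?thesis using liftable_minor[of w 0 L d f e] edf q by simp
    qed
  qed
  consider "i \<notin> {d, e, f}" | "i = d" | "i = e" | "i = f" by blast
  then show ?thesis
  proof cases
    case 1 then show ?thesis by (rule star)
  next
    case 2 then show ?thesis using center by simp
  next
    case 3 then show ?thesis using side[of e f] min w(2) dhe fhe edf h by simp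
  next
    case 4
    have "min_twice (w f) (w e) (w d + p) q" using min by (auto simp: min_twice_def)
    moreover have "{k. w k \<noteq> 0} = {d, f, e}" using w(2) by auto
    ultimately show ?thesis using side[of f e] dhf ehf def h 4 by simp
  qed
qed

section \<open>Perturbations of the graphic matroid of the complete graph\<close>

text \<open>In the numeral type the literal 6 denotes 0, so the six labels are distinct and exhaust
  the type.\<close>

lemma UNIV_6: "(UNIV :: 6 set) = {1, 2, 3, 4, 5, 6}"
proof -
  have "card {1, 2, 3, 4, 5, 6 :: 6} = card (UNIV :: 6 set)"
    by simp
  then show ?thesis by (metis card_subset_eq finite subset_UNIV)
qed

lemma forall_6: "(\<forall>k::6. P k) \<longleftrightarrow> P 1 \<and> P 2 \<and> P 3 \<and> P 4 \<and> P 5 \<and> P 6"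
  using UNIV_6 by (metis (full_types) UNIV_I insertE emptyE)

text \<open>On series of nonnegative order, taking the coefficient of exponent 0 is a ring
  homomorphism and so commutes with the determinant.\<close>

lemma hcoeff_minor:
  assumes "\<And>k. case L k of (a, b, c) \<Rightarrow> vge 0 a \<and> vge 0 b \<and> vge 0 c"
    and "\<And>k. r k = (case L k of (a, b, c) \<Rightarrow> (hcoeff a 0, hcoeff b 0, hcoeff c 0))"
  shows "hcoeff (minor L f g k) 0 = (case r f of (f1, f2, f3) \<Rightarrow> case r g of (g1, g2, g3) \<Rightarrow>
    case r k of (k1, k2, k3) \<Rightarrow>
     (f2 * g3 - f3 * g2) * k1 + (f3 * g1 - f1 * g3) * k2 + (f1 * g2 - f2 * g1) * k3)"
  using assms(1)[of f] assms(1)[of g] assms(1)[of k]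
  by (auto simp: assms(2) minor_def hcoeff_mult0 vge_mult0 vge_diff split: prod.splits)

text \<open>For infinite exponents this realizes the graphic matroid of the complete graph, with the
  triangles as its three-point lines; each exponent moves one triangle off its line. The
  coefficient 2 keeps all other minors units even when some of the exponents are 0.\<close>

definition generic_config :: "real \<Rightarrow> real \<Rightarrow> real \<Rightarrow> real \<Rightarrow> 6 config" where
  "generic_config sA sB sC sD k =
    (if k = 1 then (1, 0, 0) else if k = 2 then (0, 1, 0)
     else if k = 3 then (1, hmonom 2 sC, 1 + hmonom 2 sB)
     else if k = 4 then (1, 1 + hmonom 2 sA, hmonom 2 sD)
     else if k = 5 then (0, 0, 1) else (1, 1, 1))"

context
  fixes sA sB sC sD :: real and L :: "6 config"
  assumes s: "0 \<le> sA" "0 \<le> sB" "0 \<le> sC" "0 \<le> sD"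
  defines "L \<equiv> generic_config sA sB sC sD"
begin

lemma gc_integral: "case L k of (a, b, c) \<Rightarrow> vge 0 a \<and> vge 0 b \<and> vge 0 c"
  by (auto simp: L_def generic_config_def s intro!: vge_add vge_hmonom)

lemma gc_int: "vge 0 (minor L f g k)"
  by (rule vge_minor[OF gc_integral])

text \<open>These sixteen triples are the spanning trees of the complete graph. A perturbation term
  has residue 2 or 0 according as its exponent is 0 or positive, and every combination leaves the
  residue determinant nonzero.\<close>

lemma gc_minors:
  "vat 0 (minor L 1 2 3)" "vat 0 (minor L 1 2 5)" "vat 0 (minor L 1 2 6)" "vat 0 (minor L 1 3 4)"
  "vat 0 (minor L 1 3 6)" "vat 0 (minor L 1 4 5)" "vat 0 (minor L 1 4 6)" "vat 0 (minor L 1 5 6)"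
  "vat 0 (minor L 2 3 4)" "vat 0 (minor L 2 3 5)" "vat 0 (minor L 2 4 5)" "vat 0 (minor L 2 4 6)"
  "vat 0 (minor L 2 5 6)" "vat 0 (minor L 3 4 5)" "vat 0 (minor L 3 4 6)" "vat 0 (minor L 3 5 6)"
proof -
  define u where "u x = (if x = 0 then 2 else 0 :: complex)" for x :: real
  define r where "r k = (if k = 1 then (1 :: complex, 0, 0) else if k = 2 then (0, 1, 0)
     else if k = 3 then (1, u sC, 1 + u sB) else if k = 4 then (1, 1 + u sA, u sD)
     else if k = 5 then (0, 0, 1) else (1, 1, 1 :: complex))" for k :: 6
  have "r k = (case L k of (a, b, c) \<Rightarrow> (hcoeff a 0, hcoeff b 0, hcoeff c 0))" for k
    by (simp add: r_def u_def L_def generic_config_def)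
  note res = hcoeff_minor[OF gc_integral this]
  have u: "u x = 0 \<or> u x = 2" for x by (simp add: u_def)
  note uu = u[of sA] u[of sB] u[of sC] u[of sD]
  show "vat 0 (minor L 1 2 3)"
    by (rule vat_0I[OF gc_int]) (use uu in \<open>auto simp: res r_def\<close>)
  show "vat 0 (minor L 1 2 5)"
    by (rule vat_0I[OF gc_int]) (use uu in \<open>auto simp: res r_def\<close>)
  show "vat 0 (minor L 1 2 6)"
    by (rule vat_0I[OF gc_int]) (use uu in \<open>auto simp: res r_def\<close>)
  show "vat 0 (minor L 1 3 4)"
    by (rule vat_0I[OF gc_int]) (use uu in \<open>auto simp: res r_def\<close>)
  show "vat 0 (minor L 1 3 6)"
    by (rule vat_0I[OF gc_int]) (use uu in \<open>auto simp: res r_def\<close>)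
  show "vat 0 (minor L 1 4 5)"
    by (rule vat_0I[OF gc_int]) (use uu in \<open>auto simp: res r_def\<close>)
  show "vat 0 (minor L 1 4 6)"
    by (rule vat_0I[OF gc_int]) (use uu in \<open>auto simp: res r_def\<close>)
  show "vat 0 (minor L 1 5 6)"
    by (rule vat_0I[OF gc_int]) (use uu in \<open>auto simp: res r_def\<close>)
  show "vat 0 (minor L 2 3 4)"
    by (rule vat_0I[OF gc_int]) (use uu in \<open>auto simp: res r_def\<close>)
  show "vat 0 (minor L 2 3 5)"
    by (rule vat_0I[OF gc_int]) (use uu in \<open>auto simp: res r_def\<close>)
  show "vat 0 (minor L 2 4 5)"
    by (rule vat_0I[OF gc_int]) (use uu in \<open>auto simp: res r_def\<close>)
  show "vat 0 (minor L 2 4 6)"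
    by (rule vat_0I[OF gc_int]) (use uu in \<open>auto simp: res r_def\<close>)
  show "vat 0 (minor L 2 5 6)"
    by (rule vat_0I[OF gc_int]) (use uu in \<open>auto simp: res r_def\<close>)
  show "vat 0 (minor L 3 4 5)"
    by (rule vat_0I[OF gc_int]) (use uu in \<open>auto simp: res r_def\<close>)
  show "vat 0 (minor L 3 4 6)"
    by (rule vat_0I[OF gc_int]) (use uu in \<open>auto simp: res r_def\<close>)
  show "vat 0 (minor L 3 5 6)"
    by (rule vat_0I[OF gc_int]) (use uu in \<open>auto simp: res r_def\<close>)
qed

lemma gc_triangles:
  "vat sA (minor L 4 5 6)" "vat sB (minor L 2 3 6)" "vat sC (minor L 1 3 5)" "vat sD (minor L 1 2 4)"
  by (simp_all add: L_def generic_config_def minor_def vat_hmonom)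

lemmas gc_perms = gc_minors gc_minors[THEN vat_minor_perm(1)]
  gc_minors[THEN vat_minor_perm(2)] gc_minors[THEN vat_minor_perm(3)]
  gc_minors[THEN vat_minor_perm(4)] gc_minors[THEN vat_minor_perm(5)]

text \<open>Opposite edges lie in no common triangle.\<close>

lemma gc_opposite: "generic_pair L 1 6" "generic_pair L 2 5" "generic_pair L 3 4"
  unfolding generic_pair_def forall_6 by (simp_all add: gc_perms)

text \<open>Two adjacent edges lie in exactly one triangle, and its minor is a unit as well when its
  exponent is 0.\<close>

lemma gc_triangle_pairs:
  "sA = 0 \<Longrightarrow> generic_pair L 4 5 \<and> generic_pair L 4 6 \<and> generic_pair L 5 6"
  "sB = 0 \<Longrightarrow> generic_pair L 2 3 \<and> generic_pair L 2 6 \<and> generic_pair L 3 6"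
  "sC = 0 \<Longrightarrow> generic_pair L 1 3 \<and> generic_pair L 1 5 \<and> generic_pair L 3 5"
  "sD = 0 \<Longrightarrow> generic_pair L 1 2 \<and> generic_pair L 1 4 \<and> generic_pair L 2 4"
  unfolding generic_pair_def forall_6
  using gc_triangles gc_triangles[THEN vat_minor_perm(1)]
    gc_triangles[THEN vat_minor_perm(2)] gc_triangles[THEN vat_minor_perm(3)]
    gc_triangles[THEN vat_minor_perm(4)] gc_triangles[THEN vat_minor_perm(5)]
  by (simp_all add: gc_perms)

lemma gc_star_pairs:
  assumes "(d, e, f) \<in> {(4, 5, 6), (2, 3, 6), (1, 3, 5), (1, 2, 4)}"
  shows "\<forall>k. k \<notin> {d, e, f} \<longrightarrow> vat 0 (minor L d e k) \<and> vat 0 (minor L d f k) \<and> vat 0 (minor L e f k)"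
  using assms unfolding forall_6 by (auto simp: gc_perms)

lemma gc_liftable_star:
  assumes w: "\<And>k. 0 \<le> w k"
    and "{k. w k \<noteq> 0} = {4, 5, 6} \<and> min_twice (w 5) (w 6) (w 4) sA \<or>
      {k. w k \<noteq> 0} = {2, 3, 6} \<and> min_twice (w 3) (w 6) (w 2) sB \<or>
      {k. w k \<noteq> 0} = {1, 3, 5} \<and> min_twice (w 3) (w 5) (w 1) sC \<or>
      {k. w k \<noteq> 0} = {1, 2, 4} \<and> min_twice (w 2) (w 4) (w 1) sD"
  shows "liftable_at L w i"
proof -
  show ?thesis
    using assms(2)
  proof (elim disjE conjE)
    assume a: "{k. w k \<noteq> 0} = {4, 5, 6}" "min_twice (w 5) (w 6) (w 4) sA"
    show ?thesis
      by (rule liftable_star[OF gc_int w a(1) _ _ _ gc_triangles(1), where p = 0 and h = 1])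
         (use a(2) gc_star_pairs[of 4 5 6] in auto)
  next
    assume a: "{k. w k \<noteq> 0} = {2, 3, 6}" "min_twice (w 3) (w 6) (w 2) sB"
    show ?thesis
      by (rule liftable_star[OF gc_int w a(1) _ _ _ gc_triangles(2), where p = 0 and h = 1])
         (use a(2) gc_star_pairs[of 2 3 6] in auto)
  next
    assume a: "{k. w k \<noteq> 0} = {1, 3, 5}" "min_twice (w 3) (w 5) (w 1) sC"
    show ?thesis
      by (rule liftable_star[OF gc_int w a(1) _ _ _ gc_triangles(3), where p = 0 and h = 2])
         (use a(2) gc_star_pairs[of 1 3 5] in auto)
  next
    assume a: "{k. w k \<noteq> 0} = {1, 2, 4}" "min_twice (w 2) (w 4) (w 1) sD"
    show ?thesis
      by (rule liftable_star[OF gc_int w a(1) _ _ _ gc_triangles(4), where p = 0 and h = 3])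
         (use a(2) gc_star_pairs[of 1 2 4] in auto)
  qed
qed

end

section \<open>Configurations with parallel vectors\<close>

definition nonzero_rows :: "('k \<Rightarrow> 'n \<Rightarrow> real) \<Rightarrow> 'n \<Rightarrow> 'k set" where
  "nonzero_rows w j = {k. w k j \<noteq> 0}"

text \<open>If \<open>p > q\<close>, then \<open>c + p\<close> exceeds \<open>q\<close> and cannot
  be the minimum, so \<open>p\<close> may be capped at \<open>q\<close>. This secures the condition
  \<open>p \<le> q\<close> of the configuration below.\<close>

lemma min_twice_reduce:
  assumes "min_twice a b (c + p) q" "0 \<le> c"
  shows "min_twice a b (c + min p q) q"
  using assms unfolding min_twice_def by (cases "p \<le> q") (auto simp: min_def)

text \<open>The vectors of \<open>e5\<close> and \<open>e6\<close> are parallel to leading order, and so are those of \<open>e1\<close> and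
  \<open>e2\<close> if \<open>p'\<close> is positive. The coefficients 2 and 3 are generic enough for no leading terms
  to cancel in the minors considered.\<close>

context
  fixes e1 e2 e3 e4 e5 e6 :: "'k::finite" and p q p' q' :: real and L :: "'k config"
  assumes dist: "distinct [e1, e2, e3, e4, e5, e6]"
    and univ: "UNIV = {e1, e2, e3, e4, e5, e6}"
    and pq: "0 < p" "p \<le> q" "0 \<le> p'" "p' \<le> q'"
    and L: "L e1 = (1, 0, 0)" "L e2 = (1, hmonom 3 p', hmonom 1 q')"
      "L e3 = (1, hmonom 2 0, hmonom 2 0)" "L e4 = (0, 1, 0)" "L e5 = (0, 0, 1)"
      "L e6 = (hmonom 1 q, hmonom 1 p, 1)"
begin

lemma forall_e: "(\<forall>k. P k) \<longleftrightarrow> P e1 \<and> P e2 \<and> P e3 \<and> P e4 \<and> P e5 \<and> P e6"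
  using univ by (metis (full_types) UNIV_I insertE emptyE)

lemma sc_int: "vge 0 (minor L f g k)"
proof (rule vge_minor)
  have "\<forall>k. case L k of (a, b, c) \<Rightarrow> vge 0 a \<and> vge 0 b \<and> vge 0 c"
    unfolding forall_e using pq by (simp add: L vge_hmonom)
  then show "case L k of (a, b, c) \<Rightarrow> vge 0 a \<and> vge 0 b \<and> vge 0 c" for k
    by (rule spec)
qed

lemma sc_units:
  "vat 0 (minor L e1 e3 e4)" "vat 0 (minor L e1 e4 e5)" "vat 0 (minor L e1 e4 e6)"
  "vat 0 (minor L e2 e3 e4)" "vat 0 (minor L e2 e4 e5)" "vat 0 (minor L e2 e4 e6)"
  "vat 0 (minor L e3 e4 e5)" "vat 0 (minor L e3 e4 e6)"
  "vat 0 (minor L e1 e3 e5)" "vat 0 (minor L e1 e3 e6)"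
  using pq by (auto simp: L minor_def vat_def vge_def hmonom_mult hcoeff_monom_mult)

lemma sc_units_0:
  assumes "p' = 0"
  shows "vat 0 (minor L e2 e3 e5)" "vat 0 (minor L e2 e3 e6)"
  using pq assms by (auto simp: L minor_def vat_def vge_def hmonom_mult hcoeff_monom_mult left_diff_distrib)

lemma sc_orders:
  "vat q (minor L e4 e5 e6)" "vat p (minor L e5 e6 e1)" "vat p (minor L e5 e6 e2)"
  "vat p (minor L e5 e6 e3)"
  "vat q' (minor L e4 e1 e2)" "vat p' (minor L e1 e2 e3)" "vat p' (minor L e1 e2 e5)"
  "vat p' (minor L e1 e2 e6)"
  using pq by (auto simp: L minor_def vat_def vge_def hmonom_mult hcoeff_monom_mult)

lemmas sc_perms = sc_units sc_units[THEN vat_minor_perm(1)]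
  sc_units[THEN vat_minor_perm(2)] sc_units[THEN vat_minor_perm(3)]
  sc_units[THEN vat_minor_perm(4)] sc_units[THEN vat_minor_perm(5)]

lemma sc_pairs:
  "generic_pair L e3 e4"
  "p' = 0 \<Longrightarrow> generic_pair L e1 e3" "p' = 0 \<Longrightarrow> generic_pair L e2 e3"
  "p' = 0 \<Longrightarrow> q' = 0 \<Longrightarrow> generic_pair L e1 e2"
  "p' = 0 \<Longrightarrow> q' = 0 \<Longrightarrow> generic_pair L e1 e4"
  "p' = 0 \<Longrightarrow> q' = 0 \<Longrightarrow> generic_pair L e2 e4"
  unfolding generic_pair_def forall_e
  using sc_orders[THEN vat_minor_perm(1)] sc_orders[THEN vat_minor_perm(2)]
    sc_orders[THEN vat_minor_perm(3)] sc_orders[THEN vat_minor_perm(4)]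
    sc_orders[THEN vat_minor_perm(5)] sc_orders
  by (auto simp: sc_perms sc_units_0)

text \<open>In both triangles \<open>e4\<close> is the distinguished row; the other two vectors form
  the pair whose minors with a vector outside the triangle have order \<open>p\<close> or
  \<open>p'\<close>.\<close>

lemma sc_liftable_star:
  assumes w: "\<And>k. 0 \<le> w k"
  shows "{k. w k \<noteq> 0} = {e4, e5, e6} \<Longrightarrow> min_twice (w e5) (w e6) (w e4 + p) q \<Longrightarrow> liftable_at L w i"
    and "{k. w k \<noteq> 0} = {e4, e1, e2} \<Longrightarrow> min_twice (w e1) (w e2) (w e4 + p') q' \<Longrightarrow> liftable_at L w i"
proof -
  have 1: "\<forall>k. k \<notin> {e4, e5, e6} \<longrightarrow>
      vat p (minor L e5 e6 k) \<and> vat 0 (minor L e4 e5 k) \<and> vat 0 (minor L e4 e6 k)"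
    unfolding forall_e using sc_orders by (simp add: sc_perms)
  have 2: "\<forall>k. k \<notin> {e4, e1, e2} \<longrightarrow>
      vat p' (minor L e1 e2 k) \<and> vat 0 (minor L e4 e1 k) \<and> vat 0 (minor L e4 e2 k)"
    unfolding forall_e using sc_orders by (simp add: sc_perms)
  show "liftable_at L w i"
    if "{k. w k \<noteq> 0} = {e4, e5, e6}" "min_twice (w e5) (w e6) (w e4 + p) q"
    by (rule liftable_star[OF sc_int w that(1) _ _ _ sc_orders(1), where p = p and h = e1])
       (use 1 that(2) pq dist in auto)
  show "liftable_at L w i"
    if "{k. w k \<noteq> 0} = {e4, e1, e2}" "min_twice (w e1) (w e2) (w e4 + p') q'"
    by (rule liftable_star[OF sc_int w that(1) _ _ _ sc_orders(5), where p = p' and h = e3])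
       (use 2 that(2) pq dist in auto)
qed

end

text \<open>A tropical dependence between \<open>d\<close>, \<open>e\<close>, \<open>f\<close> and a
  fourth row, with coefficients \<open>p\<close>, 0, 0 and \<open>q\<close>, read in the columns
  positive exactly on the triangle. The last clause records what a positive \<open>p\<close> forces
  in all columns.\<close>

definition triangle_relation ::
    "('k \<Rightarrow> 'n \<Rightarrow> real) \<Rightarrow> 'k \<Rightarrow> 'k \<Rightarrow> 'k \<Rightarrow> real \<Rightarrow> real \<Rightarrow> bool" where
  "triangle_relation w d e f p q \<longleftrightarrow> 0 \<le> p \<and> 0 < q \<and>
     (\<forall>j. nonzero_rows w j = {d, e, f} \<longrightarrow> min_twice (w e j) (w f j) (w d j + p) q) \<and>
     (0 < p \<longrightarrow> (\<forall>j. w e j = 0 \<longleftrightarrow> w f j = 0))"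

text \<open>As \<open>p\<close> is positive, \<open>e5\<close> and \<open>e6\<close> vanish in the
  same columns. This rules out the two triangles containing just one of them, and
  \<open>psub\<close> with column \<open>jA\<close> rules out the pair \<open>e5\<close>,
  \<open>e6\<close>. What remains are the two triangles through \<open>e4\<close> and pairs among
  the first four rows.\<close>

lemma special_liftable:
  fixes w :: "'k::finite \<Rightarrow> 'n \<Rightarrow> real"
  assumes dist: "distinct [e1, e2, e3, e4, e5, e6]"
    and univ: "UNIV = {e1, e2, e3, e4, e5, e6}"
    and w: "\<And>k j. 0 \<le> w k j"
    and cols: "\<And>j. nonzero_rows w j \<in> {{e4, e5, e6}, {e2, e3, e6}, {e1, e3, e5}, {e1, e2, e4}} \<or>
      (\<exists>f g. f \<noteq> g \<and> nonzero_rows w j \<subseteq> {f, g})"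
    and psub: "\<And>j j' f g. f \<noteq> g \<Longrightarrow> nonzero_rows w j = {f, g} \<Longrightarrow> \<not> {f, g} \<subset> nonzero_rows w j'"
    and A: "nonzero_rows w jA = {e4, e5, e6}" "triangle_relation w e4 e5 e6 p q" "0 < p"
    and D: "(\<forall>j. nonzero_rows w j \<noteq> {e4, e1, e2}) \<and> p' = 0 \<and> q' = 0 \<or>
      nonzero_rows w jD = {e4, e1, e2} \<and> triangle_relation w e4 e1 e2 p' q'"
  shows "\<exists>L. \<forall>j i. liftable_at L (\<lambda>k. w k j) i"
proof -
  define P where "P = min p q"
  define P' where "P' = min p' q'"
  define L :: "'k config" where "L k = (if k = e1 then (1, 0, 0)
    else if k = e2 then (1, hmonom 3 P', hmonom 1 q')
    else if k = e3 then (1, hmonom 2 0, hmonom 2 0) else if k = e4 then (0, 1, 0)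
    else if k = e5 then (0, 0, 1) else (hmonom 1 q, hmonom 1 P, 1))" for k
  have pq: "0 < P" "P \<le> q" "0 \<le> P'" "P' \<le> q'"
    using A D by (auto simp: P_def P'_def triangle_relation_def)
  have L: "L e1 = (1, 0, 0)" "L e2 = (1, hmonom 3 P', hmonom 1 q')"
      "L e3 = (1, hmonom 2 0, hmonom 2 0)" "L e4 = (0, 1, 0)" "L e5 = (0, 0, 1)"
      "L e6 = (hmonom 1 q, hmonom 1 P, 1)"
    using dist by (auto simp: L_def)
  note ctxt = dist univ pq L
  have e56: "w e5 j = 0 \<longleftrightarrow> w e6 j = 0" for j using A by (auto simp: triangle_relation_def)
  have "liftable_at L (\<lambda>k. w k j) i" for j i
  proof -
    define N where "N = nonzero_rows w j"
    have N: "k \<in> N \<longleftrightarrow> w k j \<noteq> 0" for k by (simp add: N_def nonzero_rows_def)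
    have N': "{k. w k j \<noteq> 0} = N" by (simp add: N_def nonzero_rows_def)
    consider "N = {e4, e5, e6}" | "N = {e4, e1, e2}" | "N = {e2, e3, e6} \<or> N = {e1, e3, e5}"
      | f g where "f \<noteq> g" "N \<subseteq> {f, g}"
      using cols[of j] unfolding N_def by blast
    then show ?thesis
    proof cases
      case 1
      then have "min_twice (w e5 j) (w e6 j) (w e4 j + P) q"
        using A(2) w unfolding P_def N_def triangle_relation_def
        by (intro min_twice_reduce) auto
      then show ?thesis using sc_liftable_star(1)[OF ctxt, of "\<lambda>k. w k j" i] w 1 by (simp add: N')
    next
      case 2
      then have "min_twice (w e1 j) (w e2 j) (w e4 j + P') q'"
        using D w unfolding P'_def N_def triangle_relation_def
        by (intro min_twice_reduce) auto
      then show ?thesis using sc_liftable_star(2)[OF ctxt, of "\<lambda>k. w k j" i] w 2 by (simp add: N')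
    next
      case 3
      then have "e5 \<in> N \<longleftrightarrow> e6 \<notin> N" using dist by auto
      with e56[of j] show ?thesis by (simp add: N)
    next
      case 4
      have e5: "e5 \<notin> N"
      proof
        assume "e5 \<in> N"
        then have "e5 \<in> N" "e6 \<in> N" using e56[of j] by (simp_all add: N)
        then have "N = {e5, e6}" using 4 dist by auto
        then show False using psub[of e5 e6 j jA] A(1) dist by (auto simp: N_def)
      qed
      then have e6: "e6 \<notin> N" using e56[of j] by (simp add: N)
      have sub: "N \<subseteq> {e1, e2, e3, e4}" using e5 e6 univ by blast
      \<comment> \<open>A column positive exactly on two rows of the triangle \<open>e4\<close>,
        \<open>e1\<close>, \<open>e2\<close> excludes, by \<open>psub\<close>, a column positive on
        exactly these three; then \<open>D\<close> sets both exponents to 0.\<close>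
      have absent: "P' = 0 \<and> q' = 0" if "N = {a, b}" "a \<noteq> b" "c \<noteq> a" "c \<noteq> b" "{e4, e1, e2} = {a, b, c}" for a b c
      proof -
        have "nonzero_rows w jD \<noteq> {e4, e1, e2}"
          using that psub[of a b j jD] unfolding N_def by blast
        then show ?thesis using D by (simp add: P'_def)
      qed
      \<comment> \<open>A positive \<open>p'\<close> would make \<open>e1\<close> and
        \<open>e2\<close> vanish in the same columns.\<close>
      have P'0: "P' = 0" if "(e1 \<in> N) \<noteq> (e2 \<in> N)"
      proof (rule ccontr)
        assume "P' \<noteq> 0"
        then have "0 < p'" using D pq by (auto simp: P'_def triangle_relation_def)
        then have "w e1 j = 0 \<longleftrightarrow> w e2 j = 0" using D by (auto simp: triangle_relation_def)
        then show False using that by (simp add: N)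
      qed
      have "\<exists>a b h. a \<noteq> b \<and> h \<noteq> a \<and> h \<noteq> b \<and> N \<subseteq> {a, b} \<and> generic_pair L a b"
      proof (cases "e1 \<in> N \<or> e2 \<in> N")
        case False
        then have "N \<subseteq> {e3, e4}" using sub by blast
        then show ?thesis using sc_pairs(1)[OF ctxt] dist
          by (intro exI[of _ e3] exI[of _ e4] exI[of _ e1]) auto
      next
        case e12: True
        consider "N = {e1, e2}" | "N = {e1, e4}" | "N = {e2, e4}"
          | "N \<subseteq> {e1, e3}" "e1 \<in> N" | "N \<subseteq> {e2, e3}" "e2 \<in> N"
        proof -
          have two: "N = {x, y}" if "x \<in> N" "y \<in> N" "x \<noteq> y" for x y using 4 that by auto
          show thesis
          proof (cases "e4 \<in> N \<or> e1 \<in> N \<and> e2 \<in> N")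
            case True
            have "e1 \<noteq> e2" "e1 \<noteq> e4" "e2 \<noteq> e4" using dist by auto
            then have "N = {e1, e2} \<or> N = {e1, e4} \<or> N = {e2, e4}" using two True e12 by metis
            then show thesis using that(1-3) by blast
          next
            case False
            then have "N \<subseteq> {e1, e3} \<and> e1 \<in> N \<or> N \<subseteq> {e2, e3} \<and> e2 \<in> N" using sub e12 by blast
            then show thesis using that(4,5) by blast
          qed
        qed
        then show ?thesis
        proof cases
          case 1
          have "e1 \<noteq> e2" "e4 \<noteq> e1" "e4 \<noteq> e2" "{e4, e1, e2} = {e1, e2, e4}"
            using dist by fastforce+
          then have "P' = 0 \<and> q' = 0" by (rule absent[OF 1])
          then have "generic_pair L e1 e2" using sc_pairs(4)[OF ctxt] by blast
          moreover have "e1 \<noteq> e2" "e5 \<noteq> e1" "e5 \<noteq> e2" using dist by auto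
          moreover have "N \<subseteq> {e1, e2}" using 1 by blast
          ultimately show ?thesis by blast
        next
          case 2
          have "e1 \<noteq> e4" "e2 \<noteq> e1" "e2 \<noteq> e4" "{e4, e1, e2} = {e1, e4, e2}"
            using dist by fastforce+
          then have "P' = 0 \<and> q' = 0" by (rule absent[OF 2])
          then have "generic_pair L e1 e4" using sc_pairs(5)[OF ctxt] by blast
          moreover have "e1 \<noteq> e4" "e5 \<noteq> e1" "e5 \<noteq> e4" using dist by auto
          moreover have "N \<subseteq> {e1, e4}" using 2 by blast
          ultimately show ?thesis by blast
        next
          case 3
          have "e2 \<noteq> e4" "e1 \<noteq> e2" "e1 \<noteq> e4" "{e4, e1, e2} = {e2, e4, e1}"
            using dist by fastforce+
          then have "P' = 0 \<and> q' = 0" by (rule absent[OF 3])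
          then have "generic_pair L e2 e4" using sc_pairs(6)[OF ctxt] by blast
          moreover have "e2 \<noteq> e4" "e5 \<noteq> e2" "e5 \<noteq> e4" using dist by auto
          moreover have "N \<subseteq> {e2, e4}" using 3 by blast
          ultimately show ?thesis by blast
        next
          case 4
          then have "P' = 0" using dist by (intro P'0) auto
          then have "generic_pair L e1 e3" using sc_pairs(2)[OF ctxt] by blast
          moreover have "e1 \<noteq> e3" "e5 \<noteq> e1" "e5 \<noteq> e3" using dist by auto
          moreover have "N \<subseteq> {e1, e3}" using 4 by blast
          ultimately show ?thesis by blast
        next
          case 5
          then have "P' = 0" using dist by (intro P'0) auto
          then have "generic_pair L e2 e3" using sc_pairs(3)[OF ctxt] by blast
          moreover have "e2 \<noteq> e3" "e5 \<noteq> e2" "e5 \<noteq> e3" using dist by auto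
          moreover have "N \<subseteq> {e2, e3}" using 5 by blast
          ultimately show ?thesis by blast
        qed
      qed
      then obtain a b h where "a \<noteq> b" "h \<noteq> a" "h \<noteq> b" "N \<subseteq> {a, b}" "generic_pair L a b" by blast
      then show ?thesis
        using liftable_pair[OF sc_int[OF ctxt], of "\<lambda>k. w k j" a b h i] w by (simp add: N')
    qed
  qed
  then show ?thesis by blast
qed

section \<open>Relations on the triangles\<close>

lemma triangle_relation_commute: "triangle_relation w d e f p q \<longleftrightarrow> triangle_relation w d f e p q"
proof -
  have "triangle_relation w d e f p q" if "triangle_relation w d f e p q" for e f
    using that unfolding triangle_relation_def min_twice_def by (auto simp: insert_commute)
  then show ?thesis by blast
qed

lemma triangle_relation_0_rotate:
  "triangle_relation w d e f 0 q \<Longrightarrow> triangle_relation w e d f 0 q"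
  unfolding triangle_relation_def min_twice_def by (auto simp: insert_commute)

text \<open>Shift the dependence so that the least coefficient among \<open>d\<close>,
  \<open>e\<close>, \<open>f\<close> is 0. Column \<open>j0\<close> then forces a positive
  coefficient of \<open>a\<close>. A triangle row with coefficient 0 vanishes in some column, where
  a second triangle row with coefficient 0 must attain the minimum 0 too; so at most one triangle
  coefficient is positive.\<close>

lemma triangle_relation_exists:
  fixes w :: "'k \<Rightarrow> 'n \<Rightarrow> real"
  assumes dist: "distinct [a, d, e, f]"
    and w: "\<And>k j. 0 \<le> w k j"
    and cover: "\<And>k. \<exists>j. w k j = 0"
    and dep: "\<exists>p. \<forall>j. \<forall>i\<in>{a, d, e, f}. \<exists>k\<in>{a, d, e, f} - {i}. p k + w k j \<le> p i + w i j"
    and j0: "nonzero_rows w j0 = {d, e, f}"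
  shows "\<exists>p q. triangle_relation w d e f p q \<or> triangle_relation w e d f p q \<or>
    triangle_relation w f d e p q"
proof -
  obtain p0 where p0: "\<And>j i. i \<in> {a, d, e, f} \<Longrightarrow>
      \<exists>k\<in>{a, d, e, f} - {i}. p0 k + w k j \<le> p0 i + w i j"
    using dep by blast
  define m where "m = min (p0 d) (min (p0 e) (p0 f))"
  define P where "P k = p0 k - m" for k
  have P: "\<exists>k\<in>{a, d, e, f} - {i}. P k + w k j \<le> P i + w i j" if "i \<in> {a, d, e, f}" for j i
    using p0[OF that, of j] by (simp add: P_def)
  have P0: "0 \<le> P d" "0 \<le> P e" "0 \<le> P f" and Pm: "P d = 0 \<or> P e = 0 \<or> P f = 0"
    by (auto simp: P_def m_def min_def)
  have zero: "w k j = 0 \<longleftrightarrow> k \<noteq> d \<and> k \<noteq> e \<and> k \<noteq> f" if "nonzero_rows w j = {d, e, f}" for k j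
    using that by (auto simp: nonzero_rows_def)
  have pos: "0 < w k j0" if "k \<in> {d, e, f}" for k
    using that zero[OF j0, of k] w[of k j0] by auto
  have Pa: "0 < P a"
    using P[of a j0] P0 pos[of d] pos[of e] pos[of f] zero[OF j0, of a] dist by force
  have *: "triangle_relation w u v v' (P u) (P a)"
    if u: "{u, v, v'} = {d, e, f}" "distinct [a, u, v, v']" and Pv: "P v = 0" "P v' = 0" for u v v'
    unfolding triangle_relation_def
  proof (intro conjI allI impI)
    have mem: "u \<in> {d, e, f}" using u(1) by blast
    then show "0 \<le> P u" using P0 by auto
    show "0 < P a" by (rule Pa)
    have univ: "{a, d, e, f} = {a, u, v, v'}" using u(1) by blast
    have Pu: "\<exists>k. k \<in> {a, u, v, v'} \<and> k \<noteq> i \<and> P k + w k j \<le> P i + w i j"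
      if "i \<in> {a, u, v, v'}" for i j
      using P[of i j] that unfolding univ by blast
    show "min_twice (w v j) (w v' j) (w u j + P u) (P a)" if "nonzero_rows w j = {u, v, v'}" for j
    proof -
      have a0: "w a j = 0" using that u(2) by (auto simp: nonzero_rows_def)
      have "w u j + P u \<le> P a \<or> w v j \<le> P a \<or> w v' j \<le> P a"
        using Pu[of a j] a0 Pv by (auto simp: add.commute)
      moreover have "P a \<le> w u j + P u \<or> w v j \<le> w u j + P u \<or> w v' j \<le> w u j + P u"
        using Pu[of u j] a0 Pv by (auto simp: add.commute)
      moreover have "P a \<le> w v j \<or> w u j + P u \<le> w v j \<or> w v' j \<le> w v j"
        using Pu[of v j] a0 Pv by (auto simp: add.commute)
      moreover have "P a \<le> w v' j \<or> w u j + P u \<le> w v' j \<or> w v j \<le> w v' j"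
        using Pu[of v' j] a0 Pv by (auto simp: add.commute)
      ultimately show ?thesis unfolding min_twice_def by blast
    qed
    assume "0 < P u"
    \<comment> \<open>Where \<open>x\<close> vanishes the minimum is 0. Rows \<open>a\<close> and
      \<open>u\<close> have positive coefficients and stay above it, so \<open>y\<close> attains
      it.\<close>
    have imp: "w y j = 0" if x: "w x j = 0" "x = v \<and> y = v' \<or> x = v' \<and> y = v" for x y j
    proof -
      have xy: "P x = 0" "P y = 0" "x \<in> {a, u, v, v'}" using that(2) Pv by auto
      obtain k where k: "k \<in> {a, u, v, v'}" "k \<noteq> x" "P k + w k j \<le> P x + w x j"
        using Pu[OF xy(3)] by blast
      have "k = a \<or> k = u \<or> k = y" using k(1,2) that(2) by blast
      moreover have "P k + w k j \<le> 0" using k(3) xy(1) that(1) by simp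
      moreover have "0 < P a + w a j" "0 < P u + w u j"
        using Pa \<open>0 < P u\<close> w[of a j] w[of u j] by simp_all
      ultimately show ?thesis using xy(2) w[of y j] by fastforce
    qed
    show "w v j = 0 \<longleftrightarrow> w v' j = 0" for j
      using imp[of v j v'] imp[of v' j v] by blast
  qed
  have two: "P y = 0 \<or> P z = 0" if x: "{x, y, z} = {d, e, f}" and "distinct [a, x, y, z]" and Px: "P x = 0"
    for x y z
  proof -
    obtain j where j: "w x j = 0" using cover by blast
    have "x \<in> {a, d, e, f}" "{a, d, e, f} = {a, x, y, z}" using x by auto
    then obtain k where k: "k \<in> {a, y, z}" "P k + w k j \<le> 0"
      using P[of x j] j Px by auto
    moreover have "0 < P a + w a j" using Pa w[of a j] by simp
    moreover have "0 \<le> P y" "0 \<le> P z" using P0 x by (auto simp: set_eq_iff)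
    ultimately show ?thesis using w[of y j] w[of z j] by auto
  qed
  have perms: "{e, d, f} = {d, e, f}" "{f, d, e} = {d, e, f}" by auto
  have "P d = 0 \<and> P e = 0 \<or> P d = 0 \<and> P f = 0 \<or> P e = 0 \<and> P f = 0"
    using Pm two[of d e f] two[of e d f] two[of f d e] perms dist by auto
  then show ?thesis
    using *[of d e f] *[of e d f] *[of f d e] perms dist by (elim disjE) auto
qed

text \<open>If the triangle \<open>e4\<close>, \<open>e1\<close>, \<open>e2\<close> also occurs, it
  has a relation of its own. In column \<open>jA\<close> row \<open>e4\<close> is positive while
  \<open>e1\<close> and \<open>e2\<close> are 0, so \<open>e1\<close> or \<open>e2\<close> can be
  distinguished only with \<open>p' = 0\<close>, and then the three rows are
  interchangeable.\<close>

lemma special_case: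
  fixes w :: "'k::finite \<Rightarrow> 'n \<Rightarrow> real"
  assumes cover: "\<And>k. \<exists>j. w k j = 0"
    and dep: "\<And>I. card I = 4 \<Longrightarrow>
      \<exists>p. \<forall>j. \<forall>i\<in>I. \<exists>k\<in>I - {i}. p k + w k j \<le> p i + w i j"
    and w: "\<And>k j. 0 \<le> w k j"
    and psub: "\<And>j j' f g. f \<noteq> g \<Longrightarrow> nonzero_rows w j = {f, g} \<Longrightarrow> \<not> {f, g} \<subset> nonzero_rows w j'"
    and A: "nonzero_rows w jA = {e4, e5, e6}" "triangle_relation w e4 e5 e6 p q" "0 < p"
    and dist: "distinct [e1, e2, e3, e4, e5, e6]"
    and univ: "UNIV = {e1, e2, e3, e4, e5, e6}"
    and cols: "\<And>j. nonzero_rows w j \<in> {{e4, e5, e6}, {e2, e3, e6}, {e1, e3, e5}, {e1, e2, e4}} \<or>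
      (\<exists>f g. f \<noteq> g \<and> nonzero_rows w j \<subseteq> {f, g})"
  shows "\<exists>L. \<forall>j i. liftable_at L (\<lambda>k. w k j) i"
proof (cases "\<exists>jD. nonzero_rows w jD = {e4, e1, e2}")
  case False
  show ?thesis
    by (rule special_liftable[OF dist univ w cols psub A]) (use False in auto)
next
  case True
  then obtain jD where jD: "nonzero_rows w jD = {e4, e1, e2}" by blast
  have nz: "w e4 jA \<noteq> 0" "w e1 jA = 0" "w e2 jA = 0"
    using A(1) dist by (auto simp: nonzero_rows_def set_eq_iff)
  have "card {e3, e4, e1, e2} = 4" using dist by (auto simp: card_insert_if)
  note dep' = dep[OF this]
  have "distinct [e3, e4, e1, e2]" using dist by auto
  from triangle_relation_exists[OF this w cover dep' jD]
  obtain p' q' where "triangle_relation w e4 e1 e2 p' q' \<or>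
      triangle_relation w e1 e4 e2 p' q' \<or> triangle_relation w e2 e4 e1 p' q'"
    by blast
  moreover have "triangle_relation w e4 x y p' q'"
    if "triangle_relation w x e4 y p' q'" "w y jA = 0" for x y
  proof -
    have "p' = 0" using that nz by (auto simp: triangle_relation_def)
    then show ?thesis using that triangle_relation_0_rotate[of w x e4 y q'] by simp
  qed
  ultimately have "triangle_relation w e4 e1 e2 p' q'"
    using nz triangle_relation_commute[of w e4] by blast
  with jD show ?thesis
    by (intro special_liftable[OF dist univ w cols psub A, where p' = p' and q' = q' and jD = jD]) simp_all
qed

text \<open>The numbers \<open>s\<close> serve as exponents. A pair of rows can fail to be generic
  only inside a triangle with nonzero exponent; such a triangle occurs in a column, so by
  \<open>psub\<close> the pair does not. Smaller sets of nonzero rows are enlarged by an opposite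
  edge.\<close>

lemma generic_liftable:
  fixes w :: "6 \<Rightarrow> 'n \<Rightarrow> real"
  assumes w: "\<And>k j. 0 \<le> w k j"
    and cols: "\<And>j. nonzero_rows w j \<in> {{4, 5, 6}, {2, 3, 6}, {1, 3, 5}, {1, 2, 4}} \<or>
      (\<exists>f g. f \<noteq> g \<and> nonzero_rows w j \<subseteq> {f, g})"
    and psub: "\<And>j j' f g. f \<noteq> g \<Longrightarrow> nonzero_rows w j = {f, g} \<Longrightarrow> \<not> {f, g} \<subset> nonzero_rows w j'"
    and tri: "\<And>d e f. (d, e, f) \<in> {(4, 5, 6), (2, 3, 6), (1, 3, 5), (1, 2, 4)} \<Longrightarrow>
      \<exists>s\<ge>0. (s \<noteq> 0 \<longrightarrow> (\<exists>j. nonzero_rows w j = {d, e, f})) \<and>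
        (\<forall>j. nonzero_rows w j = {d, e, f} \<longrightarrow> min_twice (w e j) (w f j) (w d j) s)"
  shows "\<exists>L. \<forall>j i. liftable_at L (\<lambda>k. w k j) i"
proof -
  obtain sA where A: "0 \<le> sA" "sA \<noteq> 0 \<Longrightarrow> \<exists>j. nonzero_rows w j = {4, 5, 6}"
    "\<And>j. nonzero_rows w j = {4, 5, 6} \<Longrightarrow> min_twice (w 5 j) (w 6 j) (w 4 j) sA"
    using tri[of 4 5 6] by auto
  obtain sB where B: "0 \<le> sB" "sB \<noteq> 0 \<Longrightarrow> \<exists>j. nonzero_rows w j = {2, 3, 6}"
    "\<And>j. nonzero_rows w j = {2, 3, 6} \<Longrightarrow> min_twice (w 3 j) (w 6 j) (w 2 j) sB"
    using tri[of 2 3 6] by auto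
  obtain sC where C: "0 \<le> sC" "sC \<noteq> 0 \<Longrightarrow> \<exists>j. nonzero_rows w j = {1, 3, 5}"
    "\<And>j. nonzero_rows w j = {1, 3, 5} \<Longrightarrow> min_twice (w 3 j) (w 5 j) (w 1 j) sC"
    using tri[of 1 3 5] by auto
  obtain sD where D: "0 \<le> sD" "sD \<noteq> 0 \<Longrightarrow> \<exists>j. nonzero_rows w j = {1, 2, 4}"
    "\<And>j. nonzero_rows w j = {1, 2, 4} \<Longrightarrow> min_twice (w 2 j) (w 4 j) (w 1 j) sD"
    using tri[of 1 2 4] by auto
  note s = A(1) B(1) C(1) D(1)
  define L where "L = generic_config sA sB sC sD"
  note opp = gc_opposite[OF s, folded L_def]
  note opp' = opp[THEN generic_pair_commute[THEN iffD1]]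
  note pairs = gc_triangle_pairs[OF s, folded L_def]
  have opposite: "\<exists>g. g \<noteq> f \<and> generic_pair L f g" for f
  proof -
    have "\<forall>f. \<exists>g. g \<noteq> f \<and> generic_pair L f g"
      unfolding forall_6
      by (intro conjI; (rule exI, rule conjI[rotated], (rule opp | rule opp'), simp))
    then show ?thesis by blast
  qed
  note pairs' = pairs[unfolded generic_pair_commute[of L 4 5] generic_pair_commute[of L 4 6]
      generic_pair_commute[of L 5 6] generic_pair_commute[of L 2 3] generic_pair_commute[of L 2 6]
      generic_pair_commute[of L 3 6] generic_pair_commute[of L 1 3] generic_pair_commute[of L 1 5]
      generic_pair_commute[of L 3 5] generic_pair_commute[of L 1 2] generic_pair_commute[of L 1 4]
      generic_pair_commute[of L 2 4]]
  \<comment> \<open>Two distinct edges are either opposite or lie in a common triangle.\<close>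
  have pair: "\<forall>f g. f \<noteq> g \<longrightarrow> generic_pair L f g \<or> sA \<noteq> 0 \<and> f \<in> {4, 5, 6} \<and> g \<in> {4, 5, 6} \<or>
      sB \<noteq> 0 \<and> f \<in> {2, 3, 6} \<and> g \<in> {2, 3, 6} \<or> sC \<noteq> 0 \<and> f \<in> {1, 3, 5} \<and> g \<in> {1, 3, 5} \<or>
      sD \<noteq> 0 \<and> f \<in> {1, 2, 4} \<and> g \<in> {1, 2, 4}"
    unfolding forall_6 by (simp add: opp opp') (use pairs pairs' in blast)
  have "liftable_at L (\<lambda>k. w k j) i" for j i
  proof -
    define N where "N = nonzero_rows w j"
    have N': "{k. w k j \<noteq> 0} = N" by (simp add: N_def nonzero_rows_def)
    consider "N \<in> {{4, 5, 6}, {2, 3, 6}, {1, 3, 5}, {1, 2, 4}}" | f g where "f \<noteq> g" "N \<subseteq> {f, g}"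
      using cols[of j] unfolding N_def by blast
    then show ?thesis
    proof cases
      case 1
      then have "N = {4, 5, 6} \<or> N = {2, 3, 6} \<or> N = {1, 3, 5} \<or> N = {1, 2, 4}"
        by (simp only: insert_iff empty_iff simp_thms)
      then have "N = {4, 5, 6} \<and> min_twice (w 5 j) (w 6 j) (w 4 j) sA \<or>
          N = {2, 3, 6} \<and> min_twice (w 3 j) (w 6 j) (w 2 j) sB \<or>
          N = {1, 3, 5} \<and> min_twice (w 3 j) (w 5 j) (w 1 j) sC \<or>
          N = {1, 2, 4} \<and> min_twice (w 2 j) (w 4 j) (w 1 j) sD"
        using A(3)[of j, folded N_def] B(3)[of j, folded N_def] C(3)[of j, folded N_def]
          D(3)[of j, folded N_def] by argo
      then show ?thesis
        unfolding L_def N'[symmetric] by (intro gc_liftable_star[OF s] w)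
    next
      case 2
      have "\<exists>a b. a \<noteq> b \<and> N \<subseteq> {a, b} \<and> generic_pair L a b"
      proof (cases "N = {f, g}")
        case True
        have absent: "s = 0"
          if ex: "s \<noteq> 0 \<Longrightarrow> \<exists>j. nonzero_rows w j = T" and T: "f \<in> T" "g \<in> T" "card T = 3"
          for s :: real and T
        proof (rule ccontr)
          assume "s \<noteq> 0"
          then obtain j' where j': "nonzero_rows w j' = T" using ex by blast
          have "card {f, g} = 2" using 2(1) by simp
          then have "{f, g} \<noteq> T" using T(3) by force
          then have "{f, g} \<subset> T" using T(1,2) by blast
          then show False using psub[of f g j j'] True 2(1) j' by (simp add: N_def)
        qed
        have "f \<in> {4, 5, 6} \<Longrightarrow> g \<in> {4, 5, 6} \<Longrightarrow> sA = 0"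
          by (rule absent[OF A(2)], assumption+) simp
        moreover have "f \<in> {2, 3, 6} \<Longrightarrow> g \<in> {2, 3, 6} \<Longrightarrow> sB = 0"
          by (rule absent[OF B(2)], assumption+) simp
        moreover have "f \<in> {1, 3, 5} \<Longrightarrow> g \<in> {1, 3, 5} \<Longrightarrow> sC = 0"
          by (rule absent[OF C(2)], assumption+) simp
        moreover have "f \<in> {1, 2, 4} \<Longrightarrow> g \<in> {1, 2, 4} \<Longrightarrow> sD = 0"
          by (rule absent[OF D(2)], assumption+) simp
        ultimately have "generic_pair L f g" using pair[rule_format, OF 2(1)] by argo
        then show ?thesis using True 2 by blast
      next
        case False
        then have "N \<subseteq> {f} \<or> N \<subseteq> {g}" using 2(2) by auto
        then obtain x where x: "N \<subseteq> {x}" by blast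
        obtain y where "y \<noteq> x" "generic_pair L x y" using opposite by blast
        then show ?thesis using x by (intro exI[of _ x] exI[of _ y]) blast
      qed
      then obtain a b where ab: "a \<noteq> b" "N \<subseteq> {a, b}" "generic_pair L a b" by blast
      have "card {a, b} < card (UNIV :: 6 set)" using card_insert_le_m1[of 2 "{b}" a] by simp
      then have "{a, b} \<noteq> UNIV" by (metis less_irrefl)
      then obtain h where "h \<noteq> a" "h \<noteq> b" by blast
      with ab show ?thesis
        using liftable_pair[OF gc_int[OF s, folded L_def], of "\<lambda>k. w k j" a b h i] w
        by (simp add: N')
    qed
  qed
  then show ?thesis by blast
qed

lemma liftable_6:
  fixes w :: "6 \<Rightarrow> 'n \<Rightarrow> real"
  assumes cover: "\<And>k. \<exists>j. w k j = 0"
    and dep: "\<And>I. card I = 4 \<Longrightarrow>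
      \<exists>p. \<forall>j. \<forall>i\<in>I. \<exists>k\<in>I - {i}. p k + w k j \<le> p i + w i j"
    and w: "\<And>k j. 0 \<le> w k j"
    and psub: "\<And>j j' f g. f \<noteq> g \<Longrightarrow> nonzero_rows w j = {f, g} \<Longrightarrow> \<not> {f, g} \<subset> nonzero_rows w j'"
    and cols: "\<And>j. nonzero_rows w j \<in> {{4, 5, 6}, {2, 3, 6}, {1, 3, 5}, {1, 2, 4}} \<or>
      (\<exists>f g. f \<noteq> g \<and> nonzero_rows w j \<subseteq> {f, g})"
  shows "\<exists>L. \<forall>j i. liftable_at L (\<lambda>k. w k j) i"
proof (rule ccontr)
  assume no: "\<not> ?thesis"
  have special: "\<not> triangle_relation w e4 e5 e6 p q"
    if "nonzero_rows w j = {e4, e5, e6}" "0 < p" "distinct [e1, e2, e3, e4, e5, e6]"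
      "UNIV = {e1, e2, e3, e4, e5, e6}"
      "{{e4, e5, e6}, {e2, e3, e6}, {e1, e3, e5}, {e1, e2, e4}} =
        {{4, 5, 6}, {2, 3, 6}, {1, 3, 5}, {1, 2, 4}}"
    for e1 e2 e3 e4 e5 e6 p q j
  proof
    assume R: "triangle_relation w e4 e5 e6 p q"
    have "\<exists>L. \<forall>j i. liftable_at L (\<lambda>k. w k j) i"
      by (rule special_case[OF cover _ w _ that(1) R that(2,3,4)])
         (fact dep, fact psub, use cols in \<open>simp only: that(5)\<close>)
    with no show False by blast
  qed
  \<comment> \<open>One instance for each triangle and each choice of its distinguished row. The
    labels supplied after \<open>p\<close> extend the choice to an automorphism of the complete
    graph, so the family of triangles is preserved.\<close>
  have special': "\<And>j p q. nonzero_rows w j = {4, 5, 6} \<Longrightarrow> 0 < p \<Longrightarrow>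
      \<not> triangle_relation w 4 5 6 p q"
    "\<And>j p q. nonzero_rows w j = {4, 5, 6} \<Longrightarrow> 0 < p \<Longrightarrow>
      \<not> triangle_relation w 5 4 6 p q"
    "\<And>j p q. nonzero_rows w j = {4, 5, 6} \<Longrightarrow> 0 < p \<Longrightarrow>
      \<not> triangle_relation w 6 5 4 p q"
    "\<And>j p q. nonzero_rows w j = {2, 3, 6} \<Longrightarrow> 0 < p \<Longrightarrow>
      \<not> triangle_relation w 2 3 6 p q"
    "\<And>j p q. nonzero_rows w j = {2, 3, 6} \<Longrightarrow> 0 < p \<Longrightarrow>
      \<not> triangle_relation w 3 2 6 p q"
    "\<And>j p q. nonzero_rows w j = {2, 3, 6} \<Longrightarrow> 0 < p \<Longrightarrow>
      \<not> triangle_relation w 6 3 2 p q"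
    "\<And>j p q. nonzero_rows w j = {1, 3, 5} \<Longrightarrow> 0 < p \<Longrightarrow>
      \<not> triangle_relation w 1 5 3 p q"
    "\<And>j p q. nonzero_rows w j = {1, 3, 5} \<Longrightarrow> 0 < p \<Longrightarrow>
      \<not> triangle_relation w 5 1 3 p q"
    "\<And>j p q. nonzero_rows w j = {1, 3, 5} \<Longrightarrow> 0 < p \<Longrightarrow>
      \<not> triangle_relation w 3 5 1 p q"
    "\<And>j p q. nonzero_rows w j = {1, 2, 4} \<Longrightarrow> 0 < p \<Longrightarrow>
      \<not> triangle_relation w 4 1 2 p q"
    "\<And>j p q. nonzero_rows w j = {1, 2, 4} \<Longrightarrow> 0 < p \<Longrightarrow>
      \<not> triangle_relation w 1 4 2 p q"
    "\<And>j p q. nonzero_rows w j = {1, 2, 4} \<Longrightarrow> 0 < p \<Longrightarrow>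
      \<not> triangle_relation w 2 1 4 p q"
  subgoal for j p q by (rule special[of j _ _ _ p 1 2 3]) (simp add: insert_commute, assumption, simp,
      use UNIV_6 in \<open>simp add: insert_commute\<close>, simp only: insert_commute)
  subgoal for j p q by (rule special[of j _ _ _ p 1 3 2]) (simp add: insert_commute, assumption, simp,
      use UNIV_6 in \<open>simp add: insert_commute\<close>, simp only: insert_commute)
  subgoal for j p q by (rule special[of j _ _ _ p 3 2 1]) (simp add: insert_commute, assumption, simp,
      use UNIV_6 in \<open>simp add: insert_commute\<close>, simp only: insert_commute)
  subgoal for j p q by (rule special[of j _ _ _ p 1 4 5]) (simp add: insert_commute, assumption, simp,
      use UNIV_6 in \<open>simp add: insert_commute\<close>, simp only: insert_commute)
  subgoal for j p q by (rule special[of j _ _ _ p 1 5 4]) (simp add: insert_commute, assumption, simp,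
      use UNIV_6 in \<open>simp add: insert_commute\<close>, simp only: insert_commute)
  subgoal for j p q by (rule special[of j _ _ _ p 5 4 1]) (simp add: insert_commute, assumption, simp,
      use UNIV_6 in \<open>simp add: insert_commute\<close>, simp only: insert_commute)
  subgoal for j p q by (rule special[of j _ _ _ p 4 2 6]) (simp add: insert_commute, assumption, simp,
      use UNIV_6 in \<open>simp add: insert_commute\<close>, simp only: insert_commute)
  subgoal for j p q by (rule special[of j _ _ _ p 4 6 2]) (simp add: insert_commute, assumption, simp,
      use UNIV_6 in \<open>simp add: insert_commute\<close>, simp only: insert_commute)
  subgoal for j p q by (rule special[of j _ _ _ p 6 2 4]) (simp add: insert_commute, assumption, simp,
      use UNIV_6 in \<open>simp add: insert_commute\<close>, simp only: insert_commute)
  subgoal for j p q by (rule special[of j _ _ _ p 5 6 3]) (simp add: insert_commute, assumption, simp,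
      use UNIV_6 in \<open>simp add: insert_commute\<close>, simp only: insert_commute)
  subgoal for j p q by (rule special[of j _ _ _ p 5 3 6]) (simp add: insert_commute, assumption, simp,
      use UNIV_6 in \<open>simp add: insert_commute\<close>, simp only: insert_commute)
  subgoal for j p q by (rule special[of j _ _ _ p 3 6 5]) (simp add: insert_commute, assumption, simp,
      use UNIV_6 in \<open>simp add: insert_commute\<close>, simp only: insert_commute)
  done
  have tri: "\<exists>s\<ge>0. (s \<noteq> 0 \<longrightarrow> (\<exists>j. nonzero_rows w j = {d, e, f})) \<and>
        (\<forall>j. nonzero_rows w j = {d, e, f} \<longrightarrow> min_twice (w e j) (w f j) (w d j) s)"
    if def: "(d, e, f) \<in> {(4, 5, 6), (2, 3, 6), (1, 3, 5), (1, 2, 4)}" for d e f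
  proof (cases "\<exists>j. nonzero_rows w j = {d, e, f}")
    case False
    then show ?thesis by (intro exI[of _ 0]) simp
  next
    case True
    then obtain j where j: "nonzero_rows w j = {d, e, f}" by blast
    have dist: "distinct [d, e, f]" using def by auto
    obtain a where a: "distinct [a, d, e, f]"
    proof -
      have "distinct [1, 4, 5, 6 :: 6]" "distinct [1, 2, 3, 6 :: 6]" "distinct [2, 1, 3, 5 :: 6]"
        "distinct [3, 1, 2, 4 :: 6]" by simp_all
      then show thesis using that def by blast
    qed
    have "card {a, d, e, f} = 4" using a by simp
    from dep[OF this] obtain p q where R: "triangle_relation w d e f p q \<or>
        triangle_relation w e d f p q \<or> triangle_relation w f d e p q"
      using triangle_relation_exists[of a d e f w j] a w cover j by blast
    have "\<not> 0 < p"
    proof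
      assume p: "0 < p"
      consider "d = 4" "e = 5" "f = 6" | "d = 2" "e = 3" "f = 6" | "d = 1" "e = 3" "f = 5"
        | "d = 1" "e = 2" "f = 4"
        using def by (simp only: insert_iff empty_iff prod.inject simp_thms) blast
      then show False
      proof cases
        case 1
        show False
          using R special'(1-3)[OF j[unfolded 1] p] triangle_relation_commute[of w 6 4 5]
          unfolding 1 by blast
      next
        case 2
        show False
          using R special'(4-6)[OF j[unfolded 2] p] triangle_relation_commute[of w 6 2 3]
          unfolding 2 by blast
      next
        case 3
        show False
          using R special'(7-9)[OF j[unfolded 3] p] triangle_relation_commute[of w 1 3 5]
            triangle_relation_commute[of w 3 1 5]
          unfolding 3 by blast
      next
        case 4
        show False
          using R special'(10-12)[OF j[unfolded 4] p] triangle_relation_commute[of w 1 2 4]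
          unfolding 4 by blast
      qed
    qed
    then have "p = 0" using R by (auto simp: triangle_relation_def)
    \<comment> \<open>With all three triangle coefficients 0 any row may be listed first;
      \<open>q\<close> becomes the exponent of the triangle.\<close>
    then have "triangle_relation w d e f 0 q"
      using R by (metis triangle_relation_0_rotate triangle_relation_commute)
    then show ?thesis using True by (intro exI[of _ q]) (auto simp: triangle_relation_def)
  qed
  have "\<exists>L. \<forall>j i. liftable_at L (\<lambda>k. w k j) i"
    by (rule generic_liftable) (fact w, fact cols, fact psub, fact tri)
  with no show False by (rule notE)
qed

section \<open>From supports of the pattern to the complementary sets of positive rows\<close>

theorem theorem3p8:
  shows "\<not> (\<exists>W :: real ^ 'n ^ 6.
    trop_rank W = 3 \<and>
    kapranov_rank W > 3 \<and>
    (\<forall>u. \<exists>v. trop_pattern W $ u $ v = 0) \<and>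
    (\<forall>v. col_support (trop_pattern W) v \<in> {{1, 2, 3}, {1, 4, 5}, {2, 4, 6}, {3, 5, 6}} \<or>
         card (col_support (trop_pattern W) v) \<ge> 4) \<and>
    (\<forall>v. card (col_support (trop_pattern W) v) = 4 \<longrightarrow>
         \<not> (\<exists>v'. col_support (trop_pattern W) v' \<subset> col_support (trop_pattern W) v)))"
proof (intro notI, elim exE conjE)
  fix W :: "real ^ 'n ^ 6"
  assume rank: "trop_rank W = 3" and kap: "kapranov_rank W > 3"
    and cover: "\<forall>u. \<exists>v. trop_pattern W $ u $ v = 0"
    and supp: "\<forall>v. col_support (trop_pattern W) v \<in> {{1, 2, 3}, {1, 4, 5}, {2, 4, 6}, {3, 5, 6}} \<or>
         card (col_support (trop_pattern W) v) \<ge> 4"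
    and psub: "\<forall>v. card (col_support (trop_pattern W) v) = 4 \<longrightarrow>
         \<not> (\<exists>v'. col_support (trop_pattern W) v' \<subset> col_support (trop_pattern W) v)"
  define m where "m v = Min (range (\<lambda>i. W $ i $ v))" for v
  \<comment> \<open>The zeros of \<open>w\<close> are the zeros of the pattern, and a shift that is
    constant on each column preserves tropical dependences of rows.\<close>
  define w where "w u v = W $ u $ v - m v" for u v
  have w0: "trop_pattern W $ u $ v = 0 \<longleftrightarrow> w u v = 0" for u v
    by (simp add: trop_pattern_def w_def m_def)
  have N: "nonzero_rows w v = - col_support (trop_pattern W) v" for v
    by (auto simp: nonzero_rows_def col_support_def w0)
  have S: "col_support (trop_pattern W) v = - nonzero_rows w v" for v
    by (simp add: N)
  have cardS: "card (col_support (trop_pattern W) v) = 6 - card (nonzero_rows w v)" for v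
    using card_Diff_subset[of "nonzero_rows w v" UNIV] by (simp add: S Compl_eq_Diff_UNIV)
  have "\<exists>L. \<forall>j i. liftable_at L (\<lambda>k. w k j) i"
  proof (rule liftable_6)
    show "\<exists>j. w k j = 0" for k using cover w0 by blast
    show "0 \<le> w k j" for k j by (simp add: w_def m_def)
    show "\<exists>p. \<forall>j. \<forall>i\<in>I. \<exists>k\<in>I - {i}. p k + w k j \<le> p i + w i j" if "card I = 4" for I
      using trop_rank_dependence[of W I] rank that by (simp add: w_def)
    show "\<not> {f, g} \<subset> nonzero_rows w j'" if "f \<noteq> g" "nonzero_rows w j = {f, g}" for f g j j'
    proof -
      \<comment> \<open>A pair of nonzero rows is the complement of a support of size 4, and
        complements reverse inclusions.\<close>
      have "card (col_support (trop_pattern W) j) = 4" using that by (simp add: cardS)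
      then show ?thesis using psub that(2) unfolding S by blast
    qed
    show "nonzero_rows w j \<in> {{4, 5, 6}, {2, 3, 6}, {1, 3, 5}, {1, 2, 4}} \<or>
        (\<exists>f g. f \<noteq> g \<and> nonzero_rows w j \<subseteq> {f, g})" for j
    proof -
      \<comment> \<open>The listed supports are the vertex stars of the complete graph; the
        complement of a star is the triangle on the other three vertices.\<close>
      have compl: "- {1, 2, 3 :: 6} = {4, 5, 6}" "- {1, 4, 5 :: 6} = {2, 3, 6}"
        "- {2, 4, 6 :: 6} = {1, 3, 5}" "- {3, 5, 6 :: 6} = {1, 2, 4}"
        unfolding set_eq_iff forall_6 by simp_all
      have "\<exists>f g. f \<noteq> g \<and> nonzero_rows w j \<subseteq> {f, g}"
        if "4 \<le> card (col_support (trop_pattern W) j)"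
      proof -
        have "card (nonzero_rows w j) \<le> 2"
          using that card_mono[of UNIV "nonzero_rows w j"] by (simp add: cardS)
        moreover have "2 \<le> card (UNIV :: 6 set)" by simp
        ultimately obtain B where "nonzero_rows w j \<subseteq> B" "card B = 2"
          using exists_subset_between[of "nonzero_rows w j" 2 UNIV] by auto
        then show ?thesis by (metis card_2_iff)
      qed
      moreover have "nonzero_rows w j \<in> {{4, 5, 6}, {2, 3, 6}, {1, 3, 5}, {1, 2, 4}}"
        if "col_support (trop_pattern W) j \<in> {{1, 2, 3}, {1, 4, 5}, {2, 4, 6}, {3, 5, 6}}"
        using that unfolding N by (elim insertE emptyE) (simp_all only: compl insert_iff simp_thms)
      ultimately show ?thesis using supp[rule_format, of j] by argo
    qed
  qed
  then obtain L where "\<And>i j. liftable_at L (\<lambda>k. W $ k $ j - m j) i"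
    unfolding w_def by blast
  then have "kapranov_rank W \<le> 3" by (rule kapranov_rank_le_3)
  with kap show False by simp
qed

end
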